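(* Let $d\ge 2$. There exists a $\mathbb Z^d$-SFT $Y$ such that the problem "$Y\subseteq X$ for effective inputs $X$" is $\Pi^0_2$-complete.
   Context: For a finite alphabet $\mathcal A$ (a finite subset of $\mathbb N$), a pattern is a function $p\colon S\to\mathcal A$ with $S\subset\mathbb Z^d$ finite; it appears in $x\in\mathcal A^{\mathbb Z^d}$ if there is $u\in\mathbb Z^d$ with $x(u+s)=p(s)$ for all $s\in S$. For a set $\mathcal F$ of patterns, $X_{\mathcal F}=\{x\in\mathcal A^{\mathbb Z^d}:\text{no pattern of }\mathcal F\text{ appears in }x\}$. A (possibly empty) subshift is a set of this form; it is an SFT if $\mathcal F$ can be taken finite, and effective if $\mathcal F$ can be taken recursively enumerable. The subshift $Y$ is a fixed parameter. "The problem $Y\subseteq X$ for effective inputs" is: given an effective $\mathbb Z^d$-subshift $X$, specified by an alphabet and a Turing machine enumerating a defining set of forbidden patterns, determine whether $Y\subseteq X$. Completeness is with respect to many-one reductions. *)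

theory Defs
  imports Main "HOL-Library.FuncSet" "HOL-Library.Nat_Bijection"
begin

section \<open>Turing machines and computability\<close>

text \<open>
  Deterministic machines with one two-way infinite tape. States and tape symbols are natural
  numbers; 0 is the initial state and also the blank symbol. A machine is a finite transition
  table, of which the first matching row applies, and it halts when no row applies. So every
  machine uses finitely many states and symbols.
\<close>

datatype move = Move_Left | Stay | Move_Right

fun displacement :: "move \<Rightarrow> int" where
  "displacement Move_Left = -1"
| "displacement Stay = 0"
| "displacement Move_Right = 1"

type_synonym tm = "((nat \<times> nat) \<times> (nat \<times> nat \<times> move)) list"

text \<open>Current state, head position, tape contents.\<close>
type_synonym tm_config = "nat \<times> int \<times> (int \<Rightarrow> nat)"

fun tm_step :: "tm \<Rightarrow> tm_config \<Rightarrow> tm_config option" where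
  "tm_step M (q, h, t) =
     (case map_of M (q, t h) of
        None \<Rightarrow> None
      | Some (q', b, m) \<Rightarrow> Some (q', h + displacement m, t(h := b)))"

text \<open>The input \<open>n\<close> is written in unary, as \<open>n\<close> consecutive symbols 1.\<close>
definition tm_initial :: "nat \<Rightarrow> tm_config" where
  "tm_initial n = (0, 0, \<lambda>i. if 0 \<le> i \<and> i < int n then 1 else 0)"

text \<open>
  The output is the number of symbols 1 on the tape on halting (the convention of Davis, 1958).
  For fixed \<open>M\<close> this is (the graph of) a partial function from inputs \<open>n\<close> to outputs \<open>v\<close>.
\<close>
definition tm_computes :: "tm \<Rightarrow> nat \<Rightarrow> nat \<Rightarrow> bool" where
  "tm_computes M n v \<longleftrightarrow>
     (\<exists>q h t. (\<lambda>c c'. tm_step M c = Some c')\<^sup>*\<^sup>* (tm_initial n) (q, h, t)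
        \<and> tm_step M (q, h, t) = None \<and> v = card {i. t i = 1})"

definition computable :: "(nat \<Rightarrow> nat) \<Rightarrow> bool" where
  "computable f \<longleftrightarrow> (\<exists>M. \<forall>n. tm_computes M n (f n))"

definition decidable :: "nat set \<Rightarrow> bool" where
  "decidable A \<longleftrightarrow> computable (\<lambda>n. if n \<in> A then 1 else 0)"

definition Pi02 :: "nat set \<Rightarrow> bool" where
  "Pi02 A \<longleftrightarrow>
     (\<exists>R. decidable R \<and> A = {x. \<forall>y. \<exists>z. prod_encode (x, prod_encode (y, z)) \<in> R})"

definition many_one_reducible :: "nat set \<Rightarrow> nat set \<Rightarrow> bool" (infix \<open>\<le>\<^sub>m\<close> 50) where
  "A \<le>\<^sub>m B \<longleftrightarrow> (\<exists>f. computable f \<and> (\<forall>x. x \<in> A \<longleftrightarrow> f x \<in> B))"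

definition Pi02_complete :: "nat set \<Rightarrow> bool" where
  "Pi02_complete B \<longleftrightarrow> Pi02 B \<and> (\<forall>A. Pi02 A \<longrightarrow> A \<le>\<^sub>m B)"


section \<open>Subshifts\<close>

definition Zd :: "nat \<Rightarrow> int list set" where
  "Zd d = {v. length v = d}"

definition vadd :: "int list \<Rightarrow> int list \<Rightarrow> int list" where
  "vadd u v = map2 (+) u v"

text \<open>A pattern with support \<open>S\<close> is a partial function with domain \<open>S\<close>.\<close>
type_synonym pattern = "int list \<Rightarrow> nat option"

definition is_pattern :: "nat \<Rightarrow> nat set \<Rightarrow> pattern \<Rightarrow> bool" where
  "is_pattern d A p \<longleftrightarrow> finite (dom p) \<and> dom p \<subseteq> Zd d \<and> ran p \<subseteq> A"

definition appears_in :: "nat \<Rightarrow> pattern \<Rightarrow> (int list \<Rightarrow> nat) \<Rightarrow> bool" where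
  "appears_in d p x \<longleftrightarrow> (\<exists>u\<in>Zd d. \<forall>s\<in>dom p. p s = Some (x (vadd u s)))"

text \<open>
  Configurations are extensional functions, i.e. they have a fixed dummy value outside \<open>Zd d\<close>.
  So subshifts over different alphabets can be compared by inclusion.
\<close>
definition subshift :: "nat \<Rightarrow> nat set \<Rightarrow> pattern set \<Rightarrow> (int list \<Rightarrow> nat) set" where
  "subshift d A F = {x \<in> Zd d \<rightarrow>\<^sub>E A. \<forall>p\<in>F. \<not> appears_in d p x}"

definition sft :: "nat \<Rightarrow> (int list \<Rightarrow> nat) set \<Rightarrow> bool" where
  "sft d Y \<longleftrightarrow>
     (\<exists>A F. finite A \<and> finite F \<and> (\<forall>p\<in>F. is_pattern d A p) \<and> Y = subshift d A F)"


section \<open>Effective subshifts as inputs\<close>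

definition move_decode :: "nat \<Rightarrow> move" where
  "move_decode k = (if k mod 3 = 0 then Move_Left else if k mod 3 = 1 then Stay else Move_Right)"

definition transition_decode :: "nat \<Rightarrow> (nat \<times> nat) \<times> (nat \<times> nat \<times> move)" where
  "transition_decode k =
     (let (l, r) = prod_decode k; (q', r') = prod_decode r; (b, m) = prod_decode r'
      in (prod_decode l, (q', b, move_decode m)))"

definition tm_decode :: "nat \<Rightarrow> tm" where
  "tm_decode e = map transition_decode (list_decode e)"

definition cell_decode :: "nat \<Rightarrow> int list \<times> nat" where
  "cell_decode k = (let (s, a) = prod_decode k in (map int_decode (list_decode s), a))"

definition pattern_decode :: "nat \<Rightarrow> pattern" where
  "pattern_decode k = map_of (map cell_decode (list_decode k))"

text \<open>
  The patterns over \<open>A\<close> enumerated by \<open>M\<close>: the range of the partial function computed by \<open>M\<close>.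
  Outputs that do not code a pattern over \<open>A\<close> on \<open>Zd d\<close> are ignored, so that every machine is
  a valid input.
\<close>
definition enumerated_patterns :: "nat \<Rightarrow> nat set \<Rightarrow> tm \<Rightarrow> pattern set" where
  "enumerated_patterns d A M =
     {p. is_pattern d A p \<and> (\<exists>n v. tm_computes M n v \<and> p = pattern_decode v)}"

text \<open>An input consists of a (code of a) finite alphabet and a (code of a) Turing machine.\<close>
definition effective_subshift :: "nat \<Rightarrow> nat \<Rightarrow> (int list \<Rightarrow> nat) set" where
  "effective_subshift d i =
     (let (a, e) = prod_decode i; A = set_decode a
      in subshift d A (enumerated_patterns d A (tm_decode e)))"

definition inclusion_problem :: "nat \<Rightarrow> (int list \<Rightarrow> nat) set \<Rightarrow> nat set" where
  "inclusion_problem d Y = {i. Y \<subseteq> effective_subshift d i}"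

text \<open>Every machine, every pattern and every (alphabet, machine) pair has a code.\<close>

lemma surj_move_decode: "surj move_decode"
proof (rule surjI)
  fix m show "move_decode (case m of Move_Left \<Rightarrow> 0 | Stay \<Rightarrow> 1 | Move_Right \<Rightarrow> 2) = m"
    by (cases m) (simp_all add: move_decode_def)
qed

lemma surj_transition_decode: "surj transition_decode"
proof (rule surjI)
  fix r :: "(nat \<times> nat) \<times> (nat \<times> nat \<times> move)"
  show "transition_decode (case r of (l, q', b, m) \<Rightarrow>
      prod_encode (prod_encode l, prod_encode (q', prod_encode (b, inv move_decode m)))) = r"
    by (cases r) (simp add: transition_decode_def surj_f_inv_f[OF surj_move_decode])
qed

lemma surj_tm_decode: "surj tm_decode"
proof (rule surjI)
  fix M show "tm_decode (list_encode (map (inv transition_decode) M)) = M"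
    by (simp add: tm_decode_def comp_def surj_f_inv_f[OF surj_transition_decode])
qed

lemma surj_cell_decode: "surj cell_decode"
proof (rule surjI)
  fix c show "cell_decode (case c of (s, a) \<Rightarrow>
      prod_encode (list_encode (map int_encode s), a)) = c"
    by (cases c) (simp add: cell_decode_def comp_def)
qed

lemma pattern_decode_onto:
  assumes "finite (dom p)"
  shows "\<exists>k. pattern_decode k = p"
proof -
  obtain ks where ks: "set ks = dom p"
    using finite_list[OF assms] by blast
  define xs where "xs = map (\<lambda>s. (s, the (p s))) ks"
  have xs: "map_of xs = p"
  proof
    fix s show "map_of xs s = p s"
      unfolding xs_def map_of_map_restrict ks by (cases "p s") (simp_all add: restrict_map_def domIff)
  qed
  have "pattern_decode (list_encode (map (inv cell_decode) xs)) = p"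
    by (simp add: pattern_decode_def comp_def surj_f_inv_f[OF surj_cell_decode] xs)
  then show ?thesis ..
qed

lemma effective_subshift_onto:
  assumes "finite A"
  shows "\<exists>i. effective_subshift d i = subshift d A (enumerated_patterns d A M)"
proof -
  obtain e where "tm_decode e = M"
    using surjD[OF surj_tm_decode, of M] by blast
  then have "effective_subshift d (prod_encode (set_encode A, e))
      = subshift d A (enumerated_patterns d A M)"
    by (simp add: effective_subshift_def assms)
  then show ?thesis ..
qed

end

theory Submission
  imports Defs
begin

text \<open>
  Let \<open>Y\<close> consist of the space-time diagrams of a universal Turing machine \<open>U\<close>, with time running
  north and a wildcard symbol below the initial row. Blanks in the initial row force blanks all the
  way to their left or right, so a finite pattern determines an initial row and thereby everything
  to the north of it. This pattern occurs in \<open>Y\<close> if and only if \<open>U\<close> does not halt on the input. If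
  \<open>U\<close> searches for a \<open>z\<close> with \<open>R x y z\<close>, then the effective subshift that forbids the patterns for
  \<open>(x, y)\<close>, where \<open>y\<close> varies, contains \<open>Y\<close> if and only if \<open>\<forall>y. \<exists>z. R x y z\<close>. Conversely, by compactness
  a pattern does not occur in \<open>Y\<close> if and only if some finite box has no admissible completion of it,
  so inclusion of \<open>Y\<close> says that for every enumerated pattern there is such a box.

  Computability is obtained by compiling loop programs to machines, which gives the primitive
  recursive functions; the only unbounded search is the outermost loop of \<open>U\<close>.
\<close>

section \<open>Loop programs and their compilation to Turing machines\<close>

text \<open>The two quantifiers of \<open>Pi02\<close> have different sources: the universal one is
  the infinite list of forbidden patterns of X, the existential one is the halting of
  \<open>U\<close>. As Y is fixed before the set A is, \<open>U\<close> has to be universal, and a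
  seed carries the code of a machine deciding R besides x and y. An initial row may lack a
  predecessor under \<open>U\<close>, whence the wildcard. Nothing is required of configurations of
  Y in which no seed occurs. The reduction must output the code of a machine, so x has to be
  compiled into a transition table primitive recursively in x (an s-m-n theorem). Both membership in
  the class and universality rest on an interpreter of machines that is primitive recursive in a
  time bound.\<close>

datatype com = Skip | Inc nat | Seq com com (infixr \<open>;;\<close> 60) | Loop nat com

text \<open>
  \<open>Loop r c\<close> counts the register \<open>r\<close> down to zero. For well-formed programs, whose loop bodies do
  not use their counter, this agrees with the machine that tests \<open>r\<close> before every round.
\<close>

primrec exec :: "com \<Rightarrow> (nat \<Rightarrow> nat) \<Rightarrow> (nat \<Rightarrow> nat)" where
  "exec Skip = (\<lambda>\<sigma>. \<sigma>)"
| "exec (Inc r) = (\<lambda>\<sigma>. \<sigma>(r := Suc (\<sigma> r)))"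
| "exec (c ;; c') = (\<lambda>\<sigma>. exec c' (exec c \<sigma>))"
| "exec (Loop r c) = (\<lambda>\<sigma>. (exec c ^^ \<sigma> r) (\<sigma>(r := 0)))"

primrec regs :: "com \<Rightarrow> nat set" where
  "regs Skip = {}"
| "regs (Inc r) = {r}"
| "regs (c ;; c') = regs c \<union> regs c'"
| "regs (Loop r c) = insert r (regs c)"

primrec well_formed :: "com \<Rightarrow> bool" where
  "well_formed Skip = True"
| "well_formed (Inc r) = True"
| "well_formed (c ;; c') = (well_formed c \<and> well_formed c')"
| "well_formed (Loop r c) = (r \<notin> regs c \<and> well_formed c)"

lemma finite_regs: "finite (regs c)"
  by (induction c) auto

lemma exec_unused: "r \<notin> regs c \<Longrightarrow> exec c \<sigma> r = \<sigma> r"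
proof (induction c arbitrary: \<sigma>)
  case (Loop r' c)
  have "(exec c ^^ n) \<tau> r = \<tau> r" for n \<tau>
    by (induction n) (use Loop in auto)
  then show ?case using Loop.prems by auto
qed auto

lemma exec_upd_unused: "r \<notin> regs c \<Longrightarrow> exec c (\<sigma>(r := n)) = (exec c \<sigma>)(r := n)"
proof (induction c arbitrary: \<sigma>)
  case (Inc r')
  then show ?case by (intro ext) simp
next
  case (Seq c c')
  have "exec c (\<tau>(r := n)) = (exec c \<tau>)(r := n)" "exec c' (\<tau>(r := n)) = (exec c' \<tau>)(r := n)" for \<tau>
    using Seq.prems by (auto intro!: Seq.IH)
  then have "exec (c ;; c') (\<sigma>(r := n)) = (exec (c ;; c') \<sigma>)(r := n)" by simp
  then show ?case .
next
  case (Loop r' c)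
  have "(exec c ^^ m) (\<tau>(r := n)) = ((exec c ^^ m) \<tau>)(r := n)" for m \<tau>
  proof (induction m)
    case (Suc m)
    have "exec c (\<tau>(r := n)) = (exec c \<tau>)(r := n)" for \<tau>
      using Loop.prems by (auto intro!: Loop.IH)
    moreover have "(exec c ^^ m) (\<tau>(r := n)) = ((exec c ^^ m) \<tau>)(r := n)" by (rule Suc)
    ultimately have "(exec c ^^ Suc m) (\<tau>(r := n)) = ((exec c ^^ Suc m) \<tau>)(r := n)" by simp
    then show ?case .
  qed simp
  moreover have "\<sigma>(r := n, r' := 0) = \<sigma>(r' := 0, r := n)" using Loop.prems by auto
  ultimately have "exec (Loop r' c) (\<sigma>(r := n)) = (exec (Loop r' c) \<sigma>)(r := n)"
    using Loop.prems by simp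
  then show ?case .
qed simp

text \<open>\<open>exec\<close> clears the counter before the first round, a machine lowers it by
  one per round. Since the body commutes with updates of \<open>r\<close>, it cannot see the
  difference.\<close>

lemma exec_Loop_unfold:
  assumes "r \<notin> regs c" "\<sigma> r = Suc n"
  shows "exec (Loop r c) \<sigma> = exec (Loop r c) (exec c (\<sigma>(r := n)))"
  using assms by (simp add: exec_upd_unused funpow_swap1)

text \<open>
  Register \<open>r\<close> is held in unary on track \<open>r\<close> of the tape: the symbol in cell \<open>i \<ge> 0\<close> codes the set
  of registers whose value exceeds \<open>i\<close>. The end marker \<open>2 ^ K\<close> sits in cell \<open>-1\<close>. So a tape
  holding only register \<open>0\<close> has the form of an input, and its value is the output.
\<close>

definition tape :: "nat \<Rightarrow> (nat \<Rightarrow> nat) \<Rightarrow> int \<Rightarrow> nat" where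
  "tape K \<sigma> i = (if i = -1 then 2 ^ K else if i < 0 then 0 else set_encode {r. r < K \<and> i < int (\<sigma> r)})"

primrec csize :: "com \<Rightarrow> nat" where
  "csize Skip = 0"
| "csize (Inc r) = 3"
| "csize (c ;; c') = csize c + csize c'"
| "csize (Loop r c) = csize c + 5"

text \<open>The block of \<open>c\<close> owns the \<open>csize c\<close> states from
  \<open>s\<close> on and is left in state \<open>s + csize c\<close>. It is entered and left with
  the head on the marker, so that blocks compose by shifting \<open>s\<close>. \<open>Inc\<close>
  runs right along track \<open>r\<close> to its first free cell, adds \<open>r\<close> there and
  returns. In \<open>Loop\<close>, state \<open>s + 2\<close> sees the last cell of track
  \<open>r\<close>, or the marker if the register is zero, which means exit; \<open>s + 3\<close>
  returns, and the state after the body jumps back to \<open>s\<close>.\<close>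

primrec delta :: "nat \<Rightarrow> com \<Rightarrow> nat \<Rightarrow> nat \<Rightarrow> nat \<Rightarrow> (nat \<times> nat \<times> move) option" where
  "delta K Skip s q a = None"
| "delta K (Inc r) s q a =
     (if q = s then Some (s + 1, a, Move_Right)
      else if q = s + 1 then
        (if r \<in> set_decode a then Some (s + 1, a, Move_Right)
         else Some (s + 2, set_encode (insert r (set_decode a)), Move_Left))
      else if a = 2 ^ K then Some (s + 3, a, Stay) else Some (s + 2, a, Move_Left))"
| "delta K (c ;; c') s q a =
     (if q < s + csize c then delta K c s q a else delta K c' (s + csize c) q a)"
| "delta K (Loop r c) s q a =
     (if q = s then Some (s + 1, a, Move_Right)
      else if q = s + 1 then
        (if r \<in> set_decode a then Some (s + 1, a, Move_Right) else Some (s + 2, a, Move_Left))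
      else if q = s + 2 then
        (if a = 2 ^ K then Some (s + 5 + csize c, a, Stay)
         else Some (s + 3, set_encode (set_decode a - {r}), Move_Left))
      else if q = s + 3 then
        (if a = 2 ^ K then Some (s + 4, a, Stay) else Some (s + 3, a, Move_Left))
      else if q < s + 4 + csize c then delta K c (s + 4) q a
      else Some (s, a, Stay))"

section \<open>Runs of machines and correctness of the compiled blocks\<close>

definition moves :: "tm \<Rightarrow> tm_config \<Rightarrow> tm_config \<Rightarrow> bool" where
  "moves M c c' \<longleftrightarrow> tm_step M c = Some c'"

lemma movesI:
  "\<lbrakk>map_of M (q, t h) = Some (q', b, m); h' = h + displacement m; t(h := b) = t'\<rbrakk>
    \<Longrightarrow> moves M (q, h, t) (q', h', t')"
  by (auto simp: moves_def)

lemma moves_iff: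
  "moves M (q, h, t) c' \<longleftrightarrow>
     (\<exists>q' b m. map_of M (q, t h) = Some (q', b, m) \<and> c' = (q', h + displacement m, t(h := b)))"
  by (auto simp: moves_def split: option.splits)

abbreviation reaches :: "tm \<Rightarrow> tm_config \<Rightarrow> tm_config \<Rightarrow> bool" where
  "reaches M \<equiv> (moves M)\<^sup>*\<^sup>*"

abbreviation reaches1 :: "tm \<Rightarrow> tm_config \<Rightarrow> tm_config \<Rightarrow> bool" where
  "reaches1 M \<equiv> (moves M)\<^sup>+\<^sup>+"

lemma
  assumes "reaches M a b"
  shows reaches_trans: "reaches M b c \<Longrightarrow> reaches M a c"
    and reaches_move: "moves M b c \<Longrightarrow> reaches M a c"
    and move_reaches: "moves M c a \<Longrightarrow> reaches M c b"
    and move_reaches1: "moves M c a \<Longrightarrow> reaches1 M c b"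
  using assms by auto

lemma
  assumes "reaches1 M a b"
  shows reaches1_move: "moves M b c \<Longrightarrow> reaches1 M a c"
    and reaches1_reaches: "reaches M b c \<Longrightarrow> reaches1 M a c"
  using assms by auto

lemma tm_computes_iff:
  "tm_computes M n v \<longleftrightarrow>
     (\<exists>q h t. reaches M (tm_initial n) (q, h, t) \<and> map_of M (q, t h) = None \<and> v = card {i. t i = 1})"
proof -
  have m: "moves M = (\<lambda>c c'. tm_step M c = Some c')" by (simp add: moves_def fun_eq_iff)
  have "tm_step M (q, h, t) = None \<longleftrightarrow> map_of M (q, t h) = None" for q h t
    by (auto split: option.splits)
  then show ?thesis unfolding tm_computes_def m by presburger
qed

lemma set_encode_less: "A \<subseteq> {..<K} \<Longrightarrow> set_encode A < 2 ^ K"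
proof -
  assume "A \<subseteq> {..<K}"
  then have "set_decode (set_encode A) \<subseteq> set_decode (set_encode {..<K})"
    by (simp add: finite_subset[OF _ finite_lessThan])
  then have "set_encode A \<le> set_encode {..<K}" by (rule subset_decode_imp_le)
  also have "\<dots> = (\<Sum>i = 0..<K. 2 ^ i)" by (simp add: set_encode_def atLeast0LessThan)
  also have "\<dots> < 2 ^ K" by (simp add: sum_power2)
  finally show ?thesis .
qed

lemma tape_marker [simp]: "tape K \<sigma> (-1) = 2 ^ K"
  by (simp add: tape_def)

lemma tape_upd_marker [simp]: "(tape K \<sigma>)(-1 := 2 ^ K) = tape K \<sigma>"
  by (simp add: fun_upd_idem)

lemma tape_less: "tape K \<sigma> (int i) < 2 ^ K"
  unfolding tape_def by (auto intro!: set_encode_less)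

lemma in_set_decode_tape: "r \<in> set_decode (tape K \<sigma> (int i)) \<longleftrightarrow> r < K \<and> i < \<sigma> r"
  unfolding tape_def by simp

lemma tape_inc:
  assumes "r < K"
  shows "(tape K \<sigma>)(int (\<sigma> r) := set_encode (insert r (set_decode (tape K \<sigma> (int (\<sigma> r))))))
      = tape K (\<sigma>(r := Suc (\<sigma> r)))"
  using assms
  by (auto simp: tape_def fun_eq_iff simp del: set_encode_insert intro!: arg_cong[where f = set_encode])

lemma tape_dec:
  assumes "r < K" "\<sigma> r = Suc n"
  shows "(tape K \<sigma>)(int n := set_encode (set_decode (tape K \<sigma> (int n)) - {r}))
      = tape K (\<sigma>(r := n))"
  using assms
  by (auto simp: tape_def fun_eq_iff simp del: set_encode_insert intro!: arg_cong[where f = set_encode])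

lemma scan_right:
  assumes "\<And>a. a < 2 ^ K \<Longrightarrow> r \<in> set_decode a \<Longrightarrow> map_of M (q, a) = Some (q, a, Move_Right)"
    and "r < K"
  shows "reaches M (q, 0, tape K \<sigma>) (q, int (\<sigma> r), tape K \<sigma>)"
proof -
  have "reaches M (q, 0, tape K \<sigma>) (q, int j, tape K \<sigma>)" if "j \<le> \<sigma> r" for j
    using that
  proof (induction j)
    case (Suc j)
    have "moves M (q, int j, tape K \<sigma>) (q, int (Suc j), tape K \<sigma>)"
      using assms(1)[OF tape_less] Suc.prems \<open>r < K\<close> by (simp add: moves_iff in_set_decode_tape)
    with Suc show ?case by (meson Suc_leD rtranclp.rtrancl_into_rtrancl)
  qed simp
  then show ?thesis by simp
qed

lemma scan_left:
  assumes "\<And>a. a < 2 ^ K \<Longrightarrow> map_of M (q, a) = Some (q, a, Move_Left)"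
  shows "reaches M (q, int n - 1, tape K \<sigma>) (q, -1, tape K \<sigma>)"
proof (induction n)
  case (Suc n)
  have "moves M (q, int (Suc n) - 1, tape K \<sigma>) (q, int n - 1, tape K \<sigma>)"
    using assms[OF tape_less] by (simp add: moves_iff)
  then show ?case using Suc by (rule converse_rtranclp_into_rtranclp)
qed simp

text \<open>Nothing is assumed of the body, and at least one step is claimed: the same test serves
  the unbounded loop of \<open>search_machine\<close>, where well-formedness fails and divergence is
  proved by counting steps.\<close>

lemma loop_test:
  assumes M: "\<And>q a. s \<le> q \<Longrightarrow> q < s + csize (Loop r c) \<Longrightarrow> a \<le> 2 ^ K \<Longrightarrow>
      map_of M (q, a) = delta K (Loop r c) s q a"
    and "r < K"
  shows "reaches1 M (s, -1, tape K \<sigma>)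
    (if \<sigma> r = 0 then (s + csize (Loop r c), -1, tape K \<sigma>)
     else (s + 4, -1, tape K (\<sigma>(r := \<sigma> r - 1))))"
proof -
  have "moves M (s, -1, tape K \<sigma>) (s + 1, 0, tape K \<sigma>)"
    using M[of s "2 ^ K"] by (simp add: moves_iff)
  moreover have "reaches M (s + 1, 0, tape K \<sigma>) (s + 1, int (\<sigma> r), tape K \<sigma>)"
    using M[of "s + 1"] \<open>r < K\<close> by (intro scan_right) auto
  ultimately have 1: "reaches1 M (s, -1, tape K \<sigma>) (s + 1, int (\<sigma> r), tape K \<sigma>)"
    by (blast intro: move_reaches1)
  \<comment> \<open>One step left of the first cell without \<open>r\<close> is the last cell of the
    track, or the marker if the register is zero.\<close>
  have 2: "moves M (s + 1, int (\<sigma> r), tape K \<sigma>) (s + 2, int (\<sigma> r) - 1, tape K \<sigma>)"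
    using M[of "s + 1" "tape K \<sigma> (int (\<sigma> r))"] less_imp_le[OF tape_less]
    by (simp add: moves_iff in_set_decode_tape)
  show ?thesis
  proof (cases "\<sigma> r")
    case 0
    have 3: "moves M (s + 2, -1, tape K \<sigma>) (s + csize (Loop r c), -1, tape K \<sigma>)"
      using M[of "s + 2" "2 ^ K"] by (simp add: moves_iff add_ac)
    from 2 0 have "moves M (s + 1, int (\<sigma> r), tape K \<sigma>) (s + 2, -1, tape K \<sigma>)" by simp
    from reaches1_move[OF reaches1_move[OF 1 this] 3] 0
    show ?thesis by simp
  next
    case (Suc n)
    let ?\<sigma> = "\<sigma>(r := n)"
    have 3: "moves M (s + 2, int n, tape K \<sigma>) (s + 3, int n - 1, tape K ?\<sigma>)"
      using M[of "s + 2" "tape K \<sigma> (int n)"] tape_less[of K \<sigma> n]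
        tape_dec[where \<sigma> = \<sigma>, OF \<open>r < K\<close> Suc] by (simp add: moves_iff)
    have 4: "reaches M (s + 3, int n - 1, tape K ?\<sigma>) (s + 3, -1, tape K ?\<sigma>)"
      using M[of "s + 3"] by (intro scan_left) auto
    have 5: "moves M (s + 3, -1, tape K ?\<sigma>) (s + 4, -1, tape K ?\<sigma>)"
      using M[of "s + 3" "2 ^ K"] by (simp add: moves_iff)
    have "int (\<sigma> r) - 1 = int n" using Suc by simp
    with 2 have "moves M (s + 1, int (\<sigma> r), tape K \<sigma>) (s + 2, int n, tape K \<sigma>)" by simp
    from reaches1_reaches[OF reaches1_move[OF 1 this] move_reaches[OF reaches_move[OF 4 5] 3]]
    show ?thesis using Suc by simp
  qed
qed

lemma loop_back:
  assumes M: "\<And>q a. s \<le> q \<Longrightarrow> q < s + csize (Loop r c) \<Longrightarrow> a \<le> 2 ^ K \<Longrightarrow>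
      map_of M (q, a) = delta K (Loop r c) s q a"
  shows "moves M (s + 4 + csize c, -1, tape K \<sigma>) (s, -1, tape K \<sigma>)"
  using M[of "s + 4 + csize c" "2 ^ K"] by (simp add: moves_iff)

lemma delta_exec:
  assumes "well_formed c" "regs c \<subseteq> {..<K}"
    and "\<And>q a. s \<le> q \<Longrightarrow> q < s + csize c \<Longrightarrow> a \<le> 2 ^ K \<Longrightarrow> map_of M (q, a) = delta K c s q a"
  shows "reaches M (s, -1, tape K \<sigma>) (s + csize c, -1, tape K (exec c \<sigma>))"
  using assms
proof (induction c arbitrary: s \<sigma>)
  case (Inc r)
  have M: "map_of M (q, a) = delta K (Inc r) s q a" if "s \<le> q" "q < s + 3" "a \<le> 2 ^ K" for q a
    using Inc.prems(3)[OF that(1) _ that(3)] that(2) by simp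
  have r: "r < K" using Inc.prems(2) by simp
  let ?\<sigma> = "\<sigma>(r := Suc (\<sigma> r))"
  have 1: "moves M (s, -1, tape K \<sigma>) (s + 1, 0, tape K \<sigma>)"
    using M[of s "2 ^ K"] by (simp add: moves_iff)
  have 2: "reaches M (s + 1, 0, tape K \<sigma>) (s + 1, int (\<sigma> r), tape K \<sigma>)"
    using M[of "s + 1"] r by (intro scan_right) auto
  have 3: "moves M (s + 1, int (\<sigma> r), tape K \<sigma>) (s + 2, int (\<sigma> r) - 1, tape K ?\<sigma>)"
    using M[of "s + 1" "tape K \<sigma> (int (\<sigma> r))"] less_imp_le[OF tape_less] tape_inc[OF r]
    by (simp add: moves_iff in_set_decode_tape)
  have 4: "reaches M (s + 2, int (\<sigma> r) - 1, tape K ?\<sigma>) (s + 2, -1, tape K ?\<sigma>)"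
    using M[of "s + 2"] by (intro scan_left) auto
  have 5: "moves M (s + 2, -1, tape K ?\<sigma>) (s + 3, -1, tape K ?\<sigma>)"
    using M[of "s + 2" "2 ^ K"] by (simp add: moves_iff)
  from move_reaches[OF reaches_trans[OF 2 move_reaches[OF reaches_move[OF 4 5] 3]] 1]
  show ?case unfolding exec.simps csize.simps .
next
  case (Seq c1 c2)
  have 1: "reaches M (s, -1, tape K \<sigma>) (s + csize c1, -1, tape K (exec c1 \<sigma>))"
    using Seq.prems by (intro Seq.IH(1)) auto
  have 2: "reaches M (s + csize c1, -1, tape K (exec c1 \<sigma>))
      (s + csize c1 + csize c2, -1, tape K (exec c2 (exec c1 \<sigma>)))"
    using Seq.prems by (intro Seq.IH(2)) auto
  from reaches_trans[OF 1 2] show ?case by (simp add: add_ac)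
next
  case (Loop r c)
  have r: "r < K" "r \<notin> regs c" using Loop.prems by auto
  have body: "reaches M (s + 4, -1, tape K \<tau>) (s + 4 + csize c, -1, tape K (exec c \<tau>))" for \<tau>
    using Loop.prems by (intro Loop.IH) auto
  \<comment> \<open>Induction on the counter value with the state generalised, as a round changes
    the other registers; \<open>exec_unused\<close> keeps the body from disturbing the
    counter.\<close>
  show ?case
  proof (induction "\<sigma> r" arbitrary: \<sigma>)
    case 0
    then show ?case
      using loop_test[where \<sigma> = \<sigma>, OF Loop.prems(3) r(1)]
      by (auto simp: fun_upd_idem tranclp_into_rtranclp)
  next
    case (Suc n)
    then have n: "\<sigma> r = Suc n" by simp
    let ?\<sigma> = "exec c (\<sigma>(r := n))"
    have 1: "reaches M (s, -1, tape K \<sigma>) (s + 4, -1, tape K (\<sigma>(r := n)))"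
      using loop_test[where \<sigma> = \<sigma>, OF Loop.prems(3) r(1)] n by (auto intro: tranclp_into_rtranclp)
    have 2: "moves M (s + 4 + csize c, -1, tape K ?\<sigma>) (s, -1, tape K ?\<sigma>)"
      using loop_back[OF Loop.prems(3)] by blast
    have 3: "reaches M (s, -1, tape K ?\<sigma>) (s + csize (Loop r c), -1, tape K (exec (Loop r c) ?\<sigma>))"
      using exec_unused[OF r(2)] by (intro Suc.hyps(1)) simp
    from reaches_trans[OF 1 reaches_trans[OF body move_reaches[OF 3 2]]]
    show ?case using exec_Loop_unfold[of r c \<sigma> n] n r(2) by simp
  qed
qed simp

section \<open>Transition tables with a built-in constant\<close>

definition tabulate :: "nat \<Rightarrow> nat \<Rightarrow> (nat \<Rightarrow> nat \<Rightarrow> (nat \<times> nat \<times> move) option) \<Rightarrow> tm" where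
  "tabulate m n \<delta> = map (\<lambda>p. (p, the (\<delta> (fst p) (snd p))))
     (filter (\<lambda>p. \<delta> (fst p) (snd p) \<noteq> None) (List.product [0..<m] [0..<n]))"

lemma map_of_tabulate:
  "map_of (tabulate m n \<delta>) (q, a) = (if q < m \<and> a < n then \<delta> q a else None)"
  unfolding tabulate_def map_of_map_restrict by (cases "\<delta> q a") (auto simp: restrict_map_def)

text \<open>
  The machine for \<open>c\<close> with the constant \<open>x\<close> in register 1. State 0 steps to cell \<open>-1\<close>, state 1
  writes the end marker, the states \<open>N + x, \<dots>, N + 1\<close> write \<open>x\<close> on track 1, state \<open>N\<close> returns
  to the marker, and \<open>c\<close> runs from state 2 to the halting state \<open>2 + csize c\<close>.
\<close>

definition control :: "nat \<Rightarrow> com \<Rightarrow> nat \<Rightarrow> nat \<Rightarrow> (nat \<times> nat \<times> move) option" where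
  "control K c q a =
     (if q = 0 then Some (1, a, Move_Left)
      else if q = 1 then None
      else if q < 2 + csize c then delta K c 2 q a
      else if q = 2 + csize c then None
      else if a = 2 ^ K then Some (2, a, Stay) else Some (q, a, Move_Left))"

text \<open>Only these rows and the row of state 1 depend on the constant, by adding two rows per
  unit to a fixed table; this makes the code of \<open>machine\<close> primitive recursive in
  \<open>x\<close>. Symbols 2 and 3 are 0 and 1 with track 1 added.\<close>

primrec prelude :: "nat \<Rightarrow> tm \<Rightarrow> nat \<Rightarrow> tm" where
  "prelude N M 0 = M"
| "prelude N M (Suc j) =
     ((N + Suc j, 0), (N + j, 2, Move_Right)) # ((N + Suc j, 1), (N + j, 3, Move_Right)) # prelude N M j"

definition machine :: "nat \<Rightarrow> com \<Rightarrow> nat \<Rightarrow> tm" where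
  "machine K c x =
     ((1, 0), (3 + csize c + x, 2 ^ K, Move_Right)) #
     prelude (3 + csize c) (tabulate (4 + csize c) (Suc (2 ^ K)) (control K c)) x"

lemma map_of_prelude_le: "q \<le> N \<Longrightarrow> map_of (prelude N M x) (q, a) = map_of M (q, a)"
  by (induction x) auto

lemma map_of_prelude:
  assumes "j < x"
  shows "map_of (prelude N M x) (N + Suc j, 0) = Some (N + j, 2, Move_Right)"
    and "map_of (prelude N M x) (N + Suc j, 1) = Some (N + j, 3, Move_Right)"
  using assms by (induction x) auto

lemma map_of_machine_low:
  assumes "q \<le> 3 + csize c" "q \<noteq> 1"
  shows "map_of (machine K c x) (q, a) = (if a \<le> 2 ^ K then control K c q a else None)"
  using assms by (simp add: machine_def map_of_prelude_le map_of_tabulate)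

lemma map_of_machine_1: "map_of (machine K c x) (1, 0) = Some (3 + csize c + x, 2 ^ K, Move_Right)"
  by (simp add: machine_def)

lemma map_of_machine_prelude:
  assumes "j < x"
  shows "map_of (machine K c x) (3 + csize c + Suc j, 0) = Some (3 + csize c + j, 2, Move_Right)"
    and "map_of (machine K c x) (3 + csize c + Suc j, 1) = Some (3 + csize c + j, 3, Move_Right)"
  using map_of_prelude[OF assms, of "3 + csize c"] by (simp_all add: machine_def)

lemma map_of_machine_body:
  "\<lbrakk>2 \<le> q; q < 2 + csize c; a \<le> 2 ^ K\<rbrakk> \<Longrightarrow> map_of (machine K c x) (q, a) = delta K c 2 q a"
  by (simp add: map_of_machine_low control_def)

lemma map_of_machine_halt: "map_of (machine K c x) (2 + csize c, a) = None"
  by (simp add: map_of_machine_low control_def)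

abbreviation input :: "nat \<Rightarrow> nat \<Rightarrow> nat \<Rightarrow> nat" where
  "input y x \<equiv> (\<lambda>_. 0)(0 := y, Suc 0 := x)"

lemma tape_input:
  assumes "2 \<le> K"
  shows "tape K (input y x) i = (if i = -1 then 2 ^ K else if i < 0 then 0
    else (if i < int y then 1 else 0) + (if i < int x then 2 else 0))"
proof -
  have "{r. r < K \<and> i < int (input y x r)} =
      (if i < int y then {0} else {}) \<union> (if i < int x then {1} else {})" if "i \<ge> 0"
    using assms that by auto
  then show ?thesis by (simp add: tape_def set_encode_def)
qed

lemma machine_start:
  assumes "2 \<le> K"
  shows "reaches (machine K c x) (tm_initial y) (2, -1, tape K (input y x))"
proof -
  let ?M = "machine K c x" and ?N = "3 + csize c"
  let ?t = "\<lambda>i. if 0 \<le> i \<and> i < int y then 1 else 0 :: nat"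
  have 1: "moves ?M (tm_initial y) (1, -1, ?t)"
    using assms by (auto simp: tm_initial_def moves_iff map_of_machine_low control_def)
  have "?t(-1 := 2 ^ K) = tape K (input y 0)"
    using assms by (auto simp: fun_eq_iff tape_input)
  then have 2: "moves ?M (1, -1, ?t) (?N + x, 0, tape K (input y 0))"
    using map_of_machine_1[of K c x] by (simp add: moves_iff)
  \<comment> \<open>In state \<open>?N + (x - i)\<close> there are \<open>x - i\<close> cells left
    to mark, so the tape is that of the input with the constant \<open>i\<close>.\<close>
  have 3: "reaches ?M (?N + x, 0, tape K (input y 0)) (?N + (x - i), int i, tape K (input y i))"
    if "i \<le> x" for i
    using that
  proof (induction i)
    case (Suc i)
    then obtain j where j: "x - i = Suc j" "x - Suc i = j" "j < x"
      by (metis Suc_diff_Suc Suc_le_lessD diff_less_Suc le_less_trans less_Suc_eq_le diff_le_self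
          zero_less_Suc not_less_eq)
    have upd: "(tape K (input y i))(int i := if i < y then 3 else 2) = tape K (input y (Suc i))"
      using assms by (auto simp: fun_eq_iff tape_input)
    have "tape K (input y i) (int i) = (if i < y then 1 else 0)"
      using assms by (simp add: tape_input)
    then have "map_of ?M (?N + Suc j, tape K (input y i) (int i))
        = Some (?N + j, if i < y then 3 else 2, Move_Right)"
      using map_of_machine_prelude[OF j(3), of K c] by (simp only: if_split) simp
    then have "moves ?M (?N + Suc j, int i, tape K (input y i))
        (?N + j, int (Suc i), tape K (input y (Suc i)))"
      by (rule movesI[OF _ _ upd]) simp
    moreover have "reaches ?M (?N + x, 0, tape K (input y 0)) (?N + Suc j, int i, tape K (input y i))"
      unfolding j(1)[symmetric] by (rule Suc.IH) (use Suc.prems in simp)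
    ultimately show ?case unfolding j(2) by (rule reaches_move[rotated])
  qed simp
  have 4: "reaches ?M (?N, int x - 1 + 1, tape K (input y x)) (?N, -1, tape K (input y x))"
    using scan_left[of K ?M ?N "Suc x" "input y x"]
    by (simp add: map_of_machine_low control_def)
  have 5: "moves ?M (?N, -1, tape K (input y x)) (2, -1, tape K (input y x))"
    by (simp add: moves_iff map_of_machine_low control_def)
  have 6: "reaches ?M (?N + x, 0, tape K (input y 0)) (?N, int x - 1 + 1, tape K (input y x))"
    using 3[of x] by simp
  from move_reaches[OF move_reaches[OF reaches_trans[OF 6 reaches_move[OF 4 5]] 2] 1]
  show ?thesis .
qed

theorem machine_computes:
  assumes "2 \<le> K" "well_formed c" "regs c \<subseteq> {..<K}" "exec c (input y x) = input v 0"
  shows "tm_computes (machine K c x) y v"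
proof -
  let ?M = "machine K c x"
  have "reaches ?M (2, -1, tape K (input y x)) (2 + csize c, -1, tape K (exec c (input y x)))"
    using assms map_of_machine_body by (intro delta_exec) auto
  from reaches_trans[OF machine_start[OF assms(1)] this]
  have "reaches ?M (tm_initial y) (2 + csize c, -1, tape K (input v 0))"
    by (simp only: assms(4))
  moreover have "{i. tape K (input v 0) i = 1} = {0..<int v}"
  proof -
    \<comment> \<open>The marker stays on the tape; since it differs from 1, it is not counted in
      the output.\<close>
    have "(2::nat) ^ 1 \<le> 2 ^ K" using assms(1) by (intro power_increasing) auto
    then show ?thesis using assms(1) by (auto simp: tape_input split: if_splits)
  qed
  ultimately show ?thesis unfolding tm_computes_iff
    using map_of_machine_halt by (intro exI[of _ "2 + csize c"] exI conjI) auto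
qed

section \<open>Functions computed by loop programs\<close>

text \<open>
  The base register \<open>k\<close> is arbitrary, so that a program can be run above the registers in which
  another one keeps its values.
\<close>

definition clean :: "nat \<Rightarrow> (nat \<Rightarrow> nat) \<Rightarrow> bool" where
  "clean k \<sigma> \<longleftrightarrow> (\<forall>j\<ge>k. \<sigma> j = 0)"

definition implements :: "com \<Rightarrow> nat \<Rightarrow> (nat \<Rightarrow> nat) \<Rightarrow> bool" where
  "implements c k f \<longleftrightarrow> well_formed c \<and> regs c \<subseteq> {k..} \<and>
     (\<forall>\<sigma>. clean (Suc k) \<sigma> \<longrightarrow> exec c \<sigma> = \<sigma>(k := f (\<sigma> k)))"

definition looping :: "(nat \<Rightarrow> nat) \<Rightarrow> bool" where
  "looping f \<longleftrightarrow> (\<forall>k. \<exists>c. implements c k f)"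

lemma implementsD:
  assumes "implements c k f"
  shows "well_formed c" "regs c \<subseteq> {k..}" "clean (Suc k) \<sigma> \<Longrightarrow> exec c \<sigma> = \<sigma>(k := f (\<sigma> k))"
  using assms by (simp_all add: implements_def)

lemma loopingI: "(\<And>k. implements (c k) k f) \<Longrightarrow> looping f"
  unfolding looping_def by blast

lemma exec_add: "exec (Loop r (Inc r')) \<sigma> = \<sigma>(r := 0, r' := \<sigma> r' + \<sigma> r)" if "r \<noteq> r'"
proof -
  have "(exec (Inc r') ^^ n) \<tau> = \<tau>(r' := \<tau> r' + n)" for n \<tau>
    by (induction n) auto
  then show ?thesis using that by simp
qed

lemma exec_add2:
  assumes "r \<noteq> r1" "r \<noteq> r2" "r1 \<noteq> r2"
  shows "exec (Loop r (Inc r1 ;; Inc r2)) \<sigma> = \<sigma>(r := 0, r1 := \<sigma> r1 + \<sigma> r, r2 := \<sigma> r2 + \<sigma> r)"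
proof -
  have "(exec (Inc r1 ;; Inc r2) ^^ n) \<tau> = \<tau>(r1 := \<tau> r1 + n, r2 := \<tau> r2 + n)" for n \<tau>
    using assms by (induction n) (auto simp: fun_eq_iff)
  then show ?thesis using assms by simp
qed

lemma exec_clear: "exec (Loop r Skip) \<sigma> = \<sigma>(r := 0)"
proof -
  have "(exec Skip ^^ n) \<tau> = \<tau>" for n \<tau> by (induction n) auto
  then show ?thesis by simp
qed

lemma exec_zero: "\<sigma> r = 0 \<Longrightarrow> exec (Loop r c) \<sigma> = \<sigma>"
  by (auto simp: fun_upd_idem)

lemma exec_when: "exec (Loop r c) \<sigma> = (if \<sigma> r = 0 then \<sigma> else exec c (\<sigma>(r := 0)))" if "\<sigma> r \<le> 1"
  using that by (cases "\<sigma> r") (auto simp: fun_upd_idem)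

declare exec.simps(4) [simp del]

section \<open>Programs for the pairing function and its inverse\<close>

definition pack :: "nat \<Rightarrow> com" where
  "pack k = Loop k (Inc (k + 2) ;; Inc (k + 3)) ;; Loop (k + 1) (Inc (k + 2)) ;;
     Loop (k + 2) (Inc (k + 1) ;; Loop (k + 1) (Inc k ;; Inc (k + 4)) ;; Loop (k + 4) (Inc (k + 1))) ;;
     Loop (k + 1) Skip ;; Loop (k + 3) (Inc k)"

lemma well_formed_pack: "well_formed (pack k)" and regs_pack: "regs (pack k) \<subseteq> {k..}"
  by (auto simp: pack_def)

text \<open>\<open>prod_encode (a, b)\<close> is the triangular number of \<open>a + b\<close>, plus
  \<open>a\<close>. Register \<open>k + 2\<close> counts \<open>a + b\<close> rounds, in which
  \<open>k + 1\<close> rises through 1, 2, ... and is added to \<open>k\<close>, with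
  \<open>k + 4\<close> as the copy that restores it; \<open>k + 3\<close> keeps \<open>a\<close> for
  the end.\<close>

lemma exec_pack:
  assumes "clean (k + 2) \<sigma>"
  shows "exec (pack k) \<sigma> = \<sigma>(k := prod_encode (\<sigma> k, \<sigma> (k + 1)), k + 1 := 0)"
proof -
  let ?body = "Inc (k + 1) ;; Loop (k + 1) (Inc k ;; Inc (k + 4)) ;; Loop (k + 4) (Inc (k + 1))"
  have body: "exec ?body \<tau> = \<tau>(k := \<tau> k + Suc (\<tau> (k + 1)), k + 1 := Suc (\<tau> (k + 1)), k + 4 := 0)"
    if "\<tau> (k + 4) = 0" for \<tau>
    using that by (auto simp: exec_add exec_add2)
  have loop: "(exec ?body ^^ n) \<tau> = \<tau>(k := triangle n, k + 1 := n)"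
    if "\<tau> k = 0" "\<tau> (k + 1) = 0" "\<tau> (k + 4) = 0" for n \<tau>
  proof (induction n)
    case 0
    then show ?case using that by (auto simp: fun_eq_iff)
  next
    case (Suc n)
    show ?case unfolding funpow.simps comp_apply Suc using that
      by (subst body) (auto simp: fun_eq_iff)
  qed
  have 0: "\<sigma> (k + 2) = 0" "\<sigma> (k + 3) = 0" "\<sigma> (k + 4) = 0"
    using assms by (auto simp: clean_def)
  define a b where "a = \<sigma> k" and "b = \<sigma> (k + 1)"
  have 1: "exec (Loop k (Inc (k + 2) ;; Inc (k + 3)) ;; Loop (k + 1) (Inc (k + 2))) \<sigma>
      = \<sigma>(k := 0, k + 1 := 0, k + 2 := a + b, k + 3 := a)"
    using 0 by (auto simp: exec_add exec_add2 fun_eq_iff a_def b_def)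
  have 2: "exec (Loop (k + 2) ?body) (\<sigma>(k := 0, k + 1 := 0, k + 2 := a + b, k + 3 := a))
      = \<sigma>(k := triangle (a + b), k + 1 := a + b, k + 3 := a)"
    unfolding exec.simps(4) using 0 by (subst loop) (auto simp: fun_eq_iff)
  have 3: "exec (Loop (k + 1) Skip ;; Loop (k + 3) (Inc k))
        (\<sigma>(k := triangle (a + b), k + 1 := a + b, k + 3 := a))
      = \<sigma>(k := prod_encode (a, b), k + 1 := 0)"
    using 0 by (auto simp: exec_add exec_clear fun_eq_iff prod_encode_def)
  show ?thesis unfolding pack_def using 1 2 3 by (simp add: a_def b_def)
qed

text \<open>Decoding walks through all pairs, applying \<open>prod_decode_Suc\<close> once per unit
  of the code, with the current pair in \<open>k + 1\<close> and \<open>k + 2\<close>. Registers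
  \<open>k + 5\<close> and \<open>k + 6\<close> flag whether the second component was zero or not;
  its predecessor arises in \<open>k + 3\<close> because \<open>k + 4\<close> delays the count by
  one round.\<close>

definition unpack :: "nat \<Rightarrow> com" where
  "unpack k = Loop k (Inc (k + 5) ;;
     Loop (k + 2) (Loop (k + 4) (Inc (k + 3)) ;; Inc (k + 4)) ;;
     Loop (k + 4) (Inc (k + 6) ;; Loop (k + 5) Skip) ;;
     Loop (k + 5) (Inc (k + 3) ;; Loop (k + 1) (Inc (k + 3))) ;;
     Loop (k + 6) (Inc (k + 1)) ;; Loop (k + 3) (Inc (k + 2)))"

lemma well_formed_unpack: "well_formed (unpack k)" and regs_unpack: "regs (unpack k) \<subseteq> {k..}"
  by (auto simp: unpack_def)

text \<open>The enumeration runs along each diagonal with growing first component and enters the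
  next diagonal with first component 0.\<close>

lemma prod_decode_Suc:
  "prod_decode (Suc n) = (case prod_decode n of (a, 0) \<Rightarrow> (0, Suc a) | (a, Suc b) \<Rightarrow> (Suc a, b))"
proof -
  obtain a b where ab: "prod_decode n = (a, b)" by fastforce
  then have n: "n = prod_encode (a, b)" by (metis prod_decode_inverse)
  have "Suc n = prod_encode (case b of 0 \<Rightarrow> (0, Suc a) | Suc b \<Rightarrow> (Suc a, b))"
    by (cases b) (simp_all add: n prod_encode_def)
  then show ?thesis by (simp add: ab split: nat.splits)
qed

lemma exec_unpack:
  assumes "clean (k + 1) \<sigma>"
  shows "exec (unpack k) \<sigma> = \<sigma>(k := 0, k + 1 := fst (prod_decode (\<sigma> k)), k + 2 := snd (prod_decode (\<sigma> k)))"
proof -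
  let ?pred = "Loop (k + 4) (Inc (k + 3)) ;; Inc (k + 4)"
  let ?tail = "Loop (k + 5) (Inc (k + 3) ;; Loop (k + 1) (Inc (k + 3))) ;;
     Loop (k + 6) (Inc (k + 1)) ;; Loop (k + 3) (Inc (k + 2))"
  let ?body = "Inc (k + 5) ;; Loop (k + 2) ?pred ;;
     Loop (k + 4) (Inc (k + 6) ;; Loop (k + 5) Skip) ;; ?tail"
  have pred: "(exec ?pred ^^ Suc n) \<tau> = \<tau>(k + 3 := n, k + 4 := 1)"
    if "\<tau> (k + 3) = 0" "\<tau> (k + 4) = 0" for n \<tau>
  proof (induction n)
    case 0
    then show ?case using that by (auto simp: exec_add fun_eq_iff)
  next
    case (Suc n)
    show ?case unfolding funpow.simps(2)[of "Suc n"] comp_apply Suc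
      by (auto simp: exec_add fun_eq_iff)
  qed
  have body: "exec ?body \<tau> = (case (\<tau> (k + 1), \<tau> (k + 2)) of
      (a, 0) \<Rightarrow> \<tau>(k + 1 := 0, k + 2 := Suc a) | (a, Suc b) \<Rightarrow> \<tau>(k + 1 := Suc a, k + 2 := b))"
    if z: "\<tau> (k + 3) = 0" "\<tau> (k + 4) = 0" "\<tau> (k + 5) = 0" "\<tau> (k + 6) = 0" for \<tau>
  proof (cases "\<tau> (k + 2)")
    case 0
    have "exec (Inc (k + 5) ;; Loop (k + 2) ?pred ;;
        Loop (k + 4) (Inc (k + 6) ;; Loop (k + 5) Skip)) \<tau> = \<tau>(k + 5 := 1)"
      using z 0 by (simp add: exec_zero)
    moreover have "exec ?tail (\<tau>(k + 5 := 1)) = \<tau>(k + 1 := 0, k + 2 := Suc (\<tau> (k + 1)))"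
      unfolding exec.simps(3) using z 0
      by (subst exec_when) (auto simp: exec_add fun_eq_iff)
    ultimately show ?thesis using 0 by simp
  next
    case (Suc b)
    have 1: "exec (Loop (k + 2) ?pred) (\<tau>(k + 5 := 1)) = \<tau>(k + 2 := 0, k + 3 := b, k + 4 := 1, k + 5 := 1)"
    proof -
      have n: "(\<tau>(k + 5 := 1)) (k + 2) = Suc b" using Suc by simp
      show ?thesis unfolding exec.simps(4) n using z by (subst pred) (auto simp: fun_eq_iff)
    qed
    have "exec (Inc (k + 5)) \<tau> = \<tau>(k + 5 := 1)" using z by simp
    then have "exec ?body \<tau> = exec ?tail (exec (Loop (k + 4) (Inc (k + 6) ;; Loop (k + 5) Skip))
        (\<tau>(k + 2 := 0, k + 3 := b, k + 4 := 1, k + 5 := 1)))"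
      using 1 by (simp only: exec.simps(3))
    moreover have "exec (Loop (k + 4) (Inc (k + 6) ;; Loop (k + 5) Skip))
        (\<tau>(k + 2 := 0, k + 3 := b, k + 4 := 1, k + 5 := 1)) = \<tau>(k + 2 := 0, k + 3 := b, k + 6 := 1)"
      using z by (subst exec_when) (auto simp: exec_clear fun_eq_iff)
    moreover have "exec ?tail (\<tau>(k + 2 := 0, k + 3 := b, k + 6 := 1))
        = \<tau>(k + 1 := Suc (\<tau> (k + 1)), k + 2 := b)"
      unfolding exec.simps(3) using z
      by (subst exec_when) (auto simp: exec_add fun_eq_iff)
    ultimately show ?thesis using Suc by (simp only: case_prod_conv nat.case)
  qed
  have loop: "(exec ?body ^^ n) \<tau> = \<tau>(k + 1 := fst (prod_decode n), k + 2 := snd (prod_decode n))"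
    if "clean (k + 1) \<tau>" for n \<tau>
  proof (induction n)
    case 0
    have "prod_decode 0 = (0, 0)" by (simp add: prod_decode_def prod_decode_aux.simps)
    then show ?case using that by (auto simp: clean_def fun_eq_iff)
  next
    case (Suc n)
    show ?case unfolding funpow.simps comp_apply Suc using that
      by (subst body) (auto simp: clean_def fun_eq_iff prod_decode_Suc split: nat.splits prod.splits)
  qed
  show ?thesis unfolding unpack_def exec.simps(4) using assms
    by (subst loop) (auto simp: clean_def)
qed

section \<open>Closure properties of the functions computed by loop programs\<close>

lemma looping_id: "looping (\<lambda>n. n)"
  by (rule loopingI[of "\<lambda>_. Skip"]) (simp add: implements_def)

lemma looping_Suc: "looping Suc"
  by (rule loopingI[of Inc]) (simp add: implements_def)

lemma looping_0: "looping (\<lambda>_. 0)"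
  by (rule loopingI[of "\<lambda>k. Loop k Skip"]) (simp add: implements_def exec_clear)

lemma looping_comp: "looping (\<lambda>n. f (g n))" if "looping f" "looping g"
  unfolding looping_def
proof
  fix k
  obtain c c' where c: "implements c k f" "implements c' k g"
    using \<open>looping f\<close> \<open>looping g\<close> unfolding looping_def by blast
  have "implements (c' ;; c) k (\<lambda>n. f (g n))"
    using implementsD[OF c(1)] implementsD[OF c(2)]
    by (auto simp: implements_def clean_def)
  then show "\<exists>c. implements c k (\<lambda>n. f (g n))" ..
qed

lemma looping_pair: "looping (\<lambda>n. prod_encode (f n, g n))" if fg: "looping f" "looping g"
  unfolding looping_def
proof
  fix k
  \<comment> \<open>The two bases let the programs run in turn: \<open>c\<close> works above the
    copy of the argument in \<open>k + 1\<close>, then \<open>c'\<close> works on that copy while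
    the value of \<open>f\<close> waits in \<open>k\<close>.\<close>
  obtain c c' where c: "implements c (k + 2) f" "implements c' (k + 1) g"
    using fg unfolding looping_def by blast
  have "implements (Loop k (Inc (k + 1) ;; Inc (k + 2)) ;; c ;; Loop (k + 2) (Inc k) ;; c' ;; pack k) k
      (\<lambda>n. prod_encode (f n, g n))"
    unfolding implements_def
  proof (intro conjI allI impI)
    fix \<sigma>
    assume 0: "clean (Suc k) \<sigma>"
    then have z: "\<sigma> (k + 1) = 0" "\<sigma> (k + 2) = 0" by (auto simp: clean_def)
    have "exec (Loop k (Inc (k + 1) ;; Inc (k + 2))) \<sigma> = \<sigma>(k := 0, k + 1 := \<sigma> k, k + 2 := \<sigma> k)"
      using z by (subst exec_add2) auto
    moreover have "exec c (\<sigma>(k := 0, k + 1 := \<sigma> k, k + 2 := \<sigma> k))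
        = \<sigma>(k := 0, k + 1 := \<sigma> k, k + 2 := f (\<sigma> k))"
      using 0 by (subst implementsD(3)[OF c(1)]) (auto simp: clean_def)
    moreover have "exec (Loop (k + 2) (Inc k)) (\<sigma>(k := 0, k + 1 := \<sigma> k, k + 2 := f (\<sigma> k)))
        = \<sigma>(k := f (\<sigma> k), k + 1 := \<sigma> k)"
      using z by (subst exec_add) (auto simp: fun_eq_iff)
    moreover have "exec c' (\<sigma>(k := f (\<sigma> k), k + 1 := \<sigma> k)) = \<sigma>(k := f (\<sigma> k), k + 1 := g (\<sigma> k))"
      using 0 by (subst implementsD(3)[OF c(2)]) (auto simp: clean_def)
    moreover have "exec (pack k) (\<sigma>(k := f (\<sigma> k), k + 1 := g (\<sigma> k)))
        = \<sigma>(k := prod_encode (f (\<sigma> k), g (\<sigma> k)))"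
      using 0 by (subst exec_pack) (auto simp: clean_def fun_eq_iff)
    ultimately show "exec (Loop k (Inc (k + 1) ;; Inc (k + 2)) ;; c ;; Loop (k + 2) (Inc k) ;; c' ;; pack k) \<sigma>
        = \<sigma>(k := prod_encode (f (\<sigma> k), g (\<sigma> k)))"
      by (simp only: exec.simps(3))
  qed (use implementsD[OF c(1)] implementsD[OF c(2)] well_formed_pack regs_pack in auto)
  then show "\<exists>c. implements c k (\<lambda>n. prod_encode (f n, g n))" ..
qed

lemma looping_fst: "looping (\<lambda>n. fst (prod_decode n))"
proof (rule loopingI)
  fix k
  show "implements (unpack k ;; Loop (k + 2) Skip ;; Loop (k + 1) (Inc k)) k (\<lambda>n. fst (prod_decode n))"
    unfolding implements_def
  proof (intro conjI allI impI)
    fix \<sigma>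
    assume 0: "clean (Suc k) \<sigma>"
    show "exec (unpack k ;; Loop (k + 2) Skip ;; Loop (k + 1) (Inc k)) \<sigma> = \<sigma>(k := fst (prod_decode (\<sigma> k)))"
      unfolding exec.simps(3) using 0
      by (subst exec_unpack) (auto simp: clean_def exec_clear exec_add fun_eq_iff)
  qed (use well_formed_unpack regs_unpack in auto)
qed

lemma looping_snd: "looping (\<lambda>n. snd (prod_decode n))"
proof (rule loopingI)
  fix k
  show "implements (unpack k ;; Loop (k + 1) Skip ;; Loop (k + 2) (Inc k)) k (\<lambda>n. snd (prod_decode n))"
    unfolding implements_def
  proof (intro conjI allI impI)
    fix \<sigma>
    assume 0: "clean (Suc k) \<sigma>"
    show "exec (unpack k ;; Loop (k + 1) Skip ;; Loop (k + 2) (Inc k)) \<sigma> = \<sigma>(k := snd (prod_decode (\<sigma> k)))"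
      unfolding exec.simps(3) using 0
      by (subst exec_unpack) (auto simp: clean_def exec_clear exec_add fun_eq_iff)
  qed (use well_formed_unpack regs_unpack in auto)
qed

text \<open>Iteration is what a loop offers directly; with pairing it yields primitive recursion in
  \<open>looping_rec\<close>. The counter sits in \<open>k\<close>, below the registers of the body,
  so the loop is well formed.\<close>

lemma looping_funpow: "looping (\<lambda>n. (f ^^ snd (prod_decode n)) (fst (prod_decode n)))" if f: "looping f"
  unfolding looping_def
proof
  fix k
  obtain c where c: "implements c (k + 1) f"
    using f unfolding looping_def by blast
  let ?p = "unpack k ;; Loop (k + 2) (Inc k) ;; Loop k c ;; Loop (k + 1) (Inc k)"
  have "implements ?p k (\<lambda>n. (f ^^ snd (prod_decode n)) (fst (prod_decode n)))"
    unfolding implements_def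
  proof (intro conjI allI impI)
    fix \<sigma>
    assume 0: "clean (Suc k) \<sigma>"
    obtain a b where ab: "prod_decode (\<sigma> k) = (a, b)" by fastforce
    have iter: "(exec c ^^ n) (\<sigma>(k := 0, k + 1 := a)) = \<sigma>(k := 0, k + 1 := (f ^^ n) a)" for n
    proof (induction n)
      case (Suc n)
      show ?case unfolding funpow.simps comp_apply Suc
        using 0 by (subst implementsD(3)[OF c]) (auto simp: clean_def)
    qed simp
    have 1: "exec (unpack k) \<sigma> = \<sigma>(k := 0, k + 1 := a, k + 2 := b)"
      using 0 by (subst exec_unpack) (auto simp: ab clean_def)
    have 2: "exec (Loop (k + 2) (Inc k)) (\<sigma>(k := 0, k + 1 := a, k + 2 := b)) = \<sigma>(k := b, k + 1 := a)"
      using 0 by (subst exec_add) (auto simp: clean_def fun_eq_iff)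
    have 3: "exec (Loop k c) (\<sigma>(k := b, k + 1 := a)) = (exec c ^^ b) (\<sigma>(k := 0, k + 1 := a))"
      by (simp add: exec.simps(4) fun_upd_twist[of k "Suc k"])
    have 4: "exec (Loop (k + 1) (Inc k)) (\<sigma>(k := 0, k + 1 := (f ^^ b) a)) = \<sigma>(k := (f ^^ b) a)"
      using 0 by (subst exec_add) (auto simp: clean_def fun_eq_iff)
    show "exec ?p \<sigma> = \<sigma>(k := (f ^^ snd (prod_decode (\<sigma> k))) (fst (prod_decode (\<sigma> k))))"
      by (simp only: exec.simps(3) 1 2 3 4 iter ab fst_conv snd_conv)
  qed (use implementsD[OF c] well_formed_unpack regs_unpack in auto)
  then show "\<exists>c. implements c k (\<lambda>n. (f ^^ snd (prod_decode n)) (fst (prod_decode n)))" ..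
qed

text \<open>One program gives a family of machines: \<open>x\<close> is held by the transition table
  and only \<open>y\<close> is read from the tape. The reduction uses this to fix \<open>x\<close>
  and to enumerate over \<open>y\<close>.\<close>

theorem looping_machine:
  assumes "looping f"
  obtains K c where "2 \<le> K" "\<And>x y. tm_computes (machine K c x) y (f (prod_encode (y, x)))"
proof -
  obtain c where c: "implements c 0 f" using assms unfolding looping_def by blast
  let ?c = "pack 0 ;; c"
  define K where "K = Suc (Suc (Max (regs ?c)))"
  have K: "2 \<le> K" "regs ?c \<subseteq> {..<K}"
    using Max_ge[OF finite_regs[of ?c]]
    by (auto simp: K_def simp del: regs.simps intro: le_less_trans[of _ "Max (regs ?c)"])
  have "exec ?c (input y x) = input (f (prod_encode (y, x))) 0" for x y
  proof -
    have "exec (pack 0) (input y x) = (\<lambda>_. 0)(0 := prod_encode (y, x))"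
      by (subst exec_pack) (auto simp: clean_def fun_eq_iff)
    then show ?thesis
      by (simp, subst implementsD(3)[OF c]) (auto simp: clean_def fun_eq_iff)
  qed
  then have "tm_computes (machine K ?c x) y (f (prod_encode (y, x)))" for x y
    using K well_formed_pack implementsD[OF c] by (intro machine_computes) auto
  with K(1) show ?thesis by (rule that)
qed

corollary looping_computable:
  assumes "looping f" shows "computable f"
proof -
  have "looping (\<lambda>n. f (fst (prod_decode n)))"
    by (rule looping_comp[OF assms looping_fst])
  then show ?thesis
  proof (rule looping_machine)
    fix K c
    assume "\<And>x y. tm_computes (machine K c x) y (f (fst (prod_decode (prod_encode (y, x)))))"
    from this[of 0] have "\<forall>y. tm_computes (machine K c 0) y (f y)" by simp
    then show ?thesis unfolding computable_def by (rule exI)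
  qed
qed

section \<open>Primitive recursion on coded types\<close>

text \<open>The codes follow the decoders of the input format, so that decoding an encoded machine
  or list of cells gives it back. Injectivity lets \<open>prim_eq\<close> compare values by their
  codes.\<close>

class encodable =
  fixes enc :: "'a \<Rightarrow> nat"
  assumes enc_inject: "enc x = enc y \<Longrightarrow> x = y"

instantiation nat :: encodable
begin
definition enc_nat :: "nat \<Rightarrow> nat" where [simp]: "enc_nat n = n"
instance by standard simp
end

instantiation bool :: encodable
begin
definition enc_bool :: "bool \<Rightarrow> nat" where [simp]: "enc_bool b = of_bool b"
instance by standard (simp add: of_bool_eq_iff)
end

instantiation int :: encodable
begin
definition enc_int :: "int \<Rightarrow> nat" where [simp]: "enc_int = int_encode"
instance by standard (simp add: int_encode_eq)
end

instantiation move :: encodable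
begin
definition enc_move :: "move \<Rightarrow> nat" where
  "enc_move m = (case m of Move_Left \<Rightarrow> 0 | Stay \<Rightarrow> 1 | Move_Right \<Rightarrow> 2)"
instance by standard (simp add: enc_move_def split: move.splits)
end

instantiation prod :: (encodable, encodable) encodable
begin
definition enc_prod :: "'a \<times> 'b \<Rightarrow> nat" where "enc_prod p = prod_encode (enc (fst p), enc (snd p))"
instance by standard (auto simp: enc_prod_def prod_eq_iff intro: enc_inject)
end

instantiation option :: (encodable) encodable
begin
definition enc_option :: "'a option \<Rightarrow> nat" where
  "enc_option z = (case z of None \<Rightarrow> 0 | Some y \<Rightarrow> Suc (enc y))"
instance by standard (auto simp: enc_option_def intro: enc_inject split: option.splits)
end

instantiation list :: (encodable) encodable
begin
definition enc_list :: "'a list \<Rightarrow> nat" where "enc_list ys = list_encode (map enc ys)"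
instance
proof
  fix xs ys :: "'a list"
  assume "enc xs = enc ys"
  then have "map enc xs = map enc ys" by (simp add: enc_list_def list_encode_eq)
  then show "xs = ys" by (rule map_injective) (auto intro: injI enc_inject)
qed
end

lemma enc_Pair [simp]: "enc (x, y) = prod_encode (enc x, enc y)"
  by (simp add: enc_prod_def)

lemma enc_None [simp]: "enc None = 0" and enc_Some [simp]: "enc (Some x) = Suc (enc x)"
  by (simp_all add: enc_option_def)

lemma enc_Nil [simp]: "enc [] = 0" and enc_Cons [simp]: "enc (x # xs) = Suc (prod_encode (enc x, enc xs))"
  by (simp_all add: enc_list_def)

lemma enc_eq_iff [simp]: "enc x = enc y \<longleftrightarrow> x = y"
  using enc_inject by blast

text \<open>Provides a computable bound: a recursion over a list may run for as many rounds as its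
  code says.\<close>

lemma length_le_enc: "length xs \<le> enc xs"
proof (induction xs)
  case (Cons x xs)
  then show ?case using le_prod_encode_2[of "enc xs" "enc x"] by simp
qed simp

lemma looping_const: "looping (\<lambda>_. n)"
proof (induction n)
  case (Suc n)
  show ?case by (rule looping_comp[OF looping_Suc Suc])
qed (rule looping_0)

text \<open>The iterated state is the triple of the parameter, the counter and the value so
  far.\<close>

lemma looping_rec:
  assumes "looping n" "looping z" "looping s"
  shows "looping (\<lambda>m. rec_nat (z m) (\<lambda>k r. s (prod_encode (m, prod_encode (k, r)))) (n m))"
proof -
  let ?fst = "\<lambda>m. fst (prod_decode m)" and ?snd = "\<lambda>m. snd (prod_decode m)"
  define h where "h = (\<lambda>m. prod_encode (?fst m, prod_encode (Suc (?fst (?snd m)), s m)))"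
  have "looping (\<lambda>m. ?fst (?snd m))"
    by (rule looping_comp[OF looping_fst looping_snd])
  from looping_comp[OF looping_Suc this] have "looping h"
    unfolding h_def by (intro looping_pair looping_fst assms)
  have iter: "(h ^^ j) (prod_encode (m, prod_encode (0, z m))) =
      prod_encode (m, prod_encode (j, rec_nat (z m) (\<lambda>k r. s (prod_encode (m, prod_encode (k, r)))) j))"
    for j m
    by (induction j) (simp_all add: h_def)
  have "looping (\<lambda>m. prod_encode (prod_encode (m, prod_encode (0, z m)), n m))"
    by (intro looping_pair looping_id looping_const assms)
  from looping_comp[OF looping_funpow[OF \<open>looping h\<close>] this]
  have "looping (\<lambda>m. (h ^^ n m) (prod_encode (m, prod_encode (0, z m))))" by simp
  from looping_comp[OF looping_snd looping_comp[OF looping_snd this]]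
  show ?thesis by (simp add: iter)
qed

lemma looping_case:
  assumes "looping n" "looping z" "looping s"
  shows "looping (\<lambda>m. case n m of 0 \<Rightarrow> z m | Suc k \<Rightarrow> s (prod_encode (m, k)))"
proof -
  let ?p = "\<lambda>q. prod_encode (fst (prod_decode q), fst (prod_decode (snd (prod_decode q))))"
  have "looping ?p"
    by (intro looping_pair looping_fst looping_comp[OF looping_fst looping_snd])
  from looping_rec[OF assms(1,2) looping_comp[OF assms(3) this]]
  have "looping (\<lambda>m. rec_nat (z m) (\<lambda>k r. s (prod_encode (m, k))) (n m))" by simp
  moreover have "rec_nat (z m) (\<lambda>k r. s (prod_encode (m, k))) (n m)
      = (case n m of 0 \<Rightarrow> z m | Suc k \<Rightarrow> s (prod_encode (m, k)))" for m
    by (cases "n m") simp_all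
  ultimately show ?thesis by simp
qed

text \<open>A loop program has to track the function on codes only. The rules for
  \<open>prim\<close> follow the structure of terms, so that large definitions are handled by
  \<open>intro\<close> after unfolding.\<close>

definition prim :: "('a::encodable \<Rightarrow> 'b::encodable) \<Rightarrow> bool" where
  "prim f \<longleftrightarrow> (\<exists>g. looping g \<and> (\<forall>x. g (enc x) = enc (f x)))"

lemma primI: "looping g \<Longrightarrow> (\<And>x. g (enc x) = enc (f x)) \<Longrightarrow> prim f"
  unfolding prim_def by blast

lemma primE:
  assumes "prim f" obtains g where "looping g" "\<And>x. g (enc x) = enc (f x)"
  using assms unfolding prim_def by blast

lemma prim_looping: "prim f \<Longrightarrow> looping f" for f :: "nat \<Rightarrow> nat"
  unfolding prim_def by (metis enc_nat_def ext)

lemma prim_id: "prim (\<lambda>x. x)"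
  by (rule primI[OF looping_id]) simp

lemma prim_const: "prim (\<lambda>_. c)"
  by (rule primI[OF looping_const[of "enc c"]]) simp

lemma prim_comp:
  assumes "prim f" "prim g" shows "prim (\<lambda>x. f (g x))"
proof -
  obtain f' where f': "looping f'" "\<And>x. f' (enc x) = enc (f x)" using assms(1) unfolding prim_def by blast
  obtain g' where g': "looping g'" "\<And>x. g' (enc x) = enc (g x)" using assms(2) unfolding prim_def by blast
  show ?thesis by (rule primI[OF looping_comp[OF f'(1) g'(1)]]) (simp add: f' g')
qed

lemma prim_Pair:
  assumes "prim f" "prim g" shows "prim (\<lambda>x. (f x, g x))"
proof -
  obtain f' where f': "looping f'" "\<And>x. f' (enc x) = enc (f x)" using assms(1) unfolding prim_def by blast
  obtain g' where g': "looping g'" "\<And>x. g' (enc x) = enc (g x)" using assms(2) unfolding prim_def by blast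
  show ?thesis by (rule primI[OF looping_pair[OF f'(1) g'(1)]]) (simp add: f' g')
qed

text \<open>Functions with bound variables are handled uncurried: the context and the bound
  variables form one tuple.\<close>

lemma prim2: "prim (\<lambda>p. h (fst p) (snd p)) \<Longrightarrow> prim f \<Longrightarrow> prim g \<Longrightarrow> prim (\<lambda>x. h (f x) (g x))"
  using prim_comp[of "\<lambda>p. h (fst p) (snd p)" "\<lambda>x. (f x, g x)"] prim_Pair[of f g] by simp

lemma prim3:
  "prim (\<lambda>p. h (fst p) (fst (snd p)) (snd (snd p))) \<Longrightarrow> prim f \<Longrightarrow> prim g \<Longrightarrow> prim k
    \<Longrightarrow> prim (\<lambda>x. h (f x) (g x) (k x))"
  using prim_comp[of "\<lambda>p. h (fst p) (fst (snd p)) (snd (snd p))" "\<lambda>x. (f x, g x, k x)"]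
    prim_Pair[of f "\<lambda>x. (g x, k x)"] prim_Pair[of g k] by simp

lemma prim_fst: assumes "prim f" shows "prim (\<lambda>x. fst (f x))"
proof -
  have "prim fst" by (rule primI[OF looping_fst]) (simp add: enc_prod_def)
  then show ?thesis using assms by (rule prim_comp)
qed

lemma prim_snd: assumes "prim f" shows "prim (\<lambda>x. snd (f x))"
proof -
  have "prim snd" by (rule primI[OF looping_snd]) (simp add: enc_prod_def)
  then show ?thesis using assms by (rule prim_comp)
qed

lemma prim_enc: "prim f \<Longrightarrow> prim (\<lambda>x. enc (f x))"
  unfolding prim_def by simp

lemma prim_Suc: assumes "prim f" shows "prim (\<lambda>x. Suc (f x))"
proof -
  have "prim Suc" by (rule primI[OF looping_Suc]) simp
  then show ?thesis using assms by (rule prim_comp)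
qed

lemma prim_rec_nat:
  assumes "prim n" "prim z" "prim (\<lambda>p. s (fst p) (fst (snd p)) (snd (snd p)))"
  shows "prim (\<lambda>x. rec_nat (z x) (s x) (n x))"
proof -
  obtain n' where n': "looping n'" "\<And>x. n' (enc x) = enc (n x)" using assms(1) unfolding prim_def by blast
  obtain z' where z': "looping z'" "\<And>x. z' (enc x) = enc (z x)" using assms(2) unfolding prim_def by blast
  obtain s' where s': "looping s'" "\<And>p. s' (enc p) = enc (s (fst p) (fst (snd p)) (snd (snd p)))"
    using assms(3) unfolding prim_def by blast
  have s'': "s' (prod_encode (enc x, prod_encode (k, enc r))) = enc (s x k r)" for x k r
    using s'(2)[of "(x, k, r)"] by simp
  have "rec_nat (enc (z x)) (\<lambda>k r. s' (prod_encode (enc x, prod_encode (k, r)))) j = enc (rec_nat (z x) (s x) j)"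
    for x j by (induction j) (simp_all add: s'')
  then show ?thesis
    by (intro primI[OF looping_rec[OF n'(1) z'(1) s'(1)]]) (simp add: n' z')
qed

lemma prim_case_nat:
  assumes "prim n" "prim z" "prim (\<lambda>p. s (fst p) (snd p))"
  shows "prim (\<lambda>x. case n x of 0 \<Rightarrow> z x | Suc k \<Rightarrow> s x k)"
proof -
  have "prim (\<lambda>x. rec_nat (z x) (\<lambda>k _. s x k) (n x))"
    by (intro prim_rec_nat assms prim2[OF assms(3)] prim_fst prim_snd prim_id)
  moreover have "rec_nat (z x) (\<lambda>k _. s x k) (n x) = (case n x of 0 \<Rightarrow> z x | Suc k \<Rightarrow> s x k)" for x
    by (cases "n x") simp_all
  ultimately show ?thesis by simp
qed

lemma prim_case_option:
  assumes "prim n" "prim z" "prim (\<lambda>p. s (fst p) (snd p))"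
  shows "prim (\<lambda>x. case n x of None \<Rightarrow> z x | Some y \<Rightarrow> s x y)"
proof -
  obtain n' where n': "looping n'" "\<And>x. n' (enc x) = enc (n x)" using assms(1) unfolding prim_def by blast
  obtain z' where z': "looping z'" "\<And>x. z' (enc x) = enc (z x)" using assms(2) unfolding prim_def by blast
  obtain s' where s': "looping s'" "\<And>p. s' (enc p) = enc (s (fst p) (snd p))"
    using assms(3) unfolding prim_def by blast
  have "s' (prod_encode (enc x, enc y)) = enc (s x y)" for x y
    using s'(2)[of "(x, y)"] by simp
  then show ?thesis
    by (intro primI[OF looping_case[OF n'(1) z'(1) s'(1)]]) (simp add: n' z' split: option.splits)
qed

lemma prim_case_list:
  assumes "prim n" "prim z" "prim (\<lambda>p. s (fst p) (fst (snd p)) (snd (snd p)))"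
  shows "prim (\<lambda>x. case n x of [] \<Rightarrow> z x | y # ys \<Rightarrow> s x y ys)"
proof -
  obtain n' where n': "looping n'" "\<And>x. n' (enc x) = enc (n x)" using assms(1) unfolding prim_def by blast
  obtain z' where z': "looping z'" "\<And>x. z' (enc x) = enc (z x)" using assms(2) unfolding prim_def by blast
  obtain s' where s': "looping s'" "\<And>p. s' (enc p) = enc (s (fst p) (fst (snd p)) (snd (snd p)))"
    using assms(3) unfolding prim_def by blast
  have "s' (prod_encode (enc x, prod_encode (enc y, enc ys))) = enc (s x y ys)" for x y ys
    using s'(2)[of "(x, y, ys)"] by simp
  then show ?thesis
    by (intro primI[OF looping_case[OF n'(1) z'(1) s'(1)]]) (simp add: n' z' split: list.splits)
qed

lemma prim_Some: assumes "prim f" shows "prim (\<lambda>x. Some (f x))"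
proof -
  have "prim Some" by (rule primI[OF looping_Suc]) simp
  then show ?thesis using assms by (rule prim_comp)
qed

lemma prim_Cons: assumes "prim f" "prim g" shows "prim (\<lambda>x. f x # g x)"
proof -
  have "prim (\<lambda>p. fst p # snd p)" by (rule primI[OF looping_Suc]) (simp add: enc_prod_def)
  then show ?thesis using assms by (rule prim2)
qed

lemma prim_If:
  assumes "prim b" "prim f" "prim g" shows "prim (\<lambda>x. if b x then f x else g x)"
proof -
  have "prim (\<lambda>x. case enc (b x) of 0 \<Rightarrow> g x | Suc k \<Rightarrow> f x)"
    by (intro prim_case_nat prim_enc prim_comp[OF assms(2)] prim_fst prim_id assms)
  moreover have "(case enc (b x) of 0 \<Rightarrow> g x | Suc k \<Rightarrow> f x) = (if b x then f x else g x)" for x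
    by simp
  ultimately show ?thesis by simp
qed

lemmas prim_basic = prim_id prim_const prim_Pair prim_fst prim_snd prim_enc prim_Suc prim_rec_nat
  prim_case_nat prim_case_option prim_case_list prim_Some prim_Cons prim_If

section \<open>Logic and arithmetic\<close>

lemma prim_not: assumes "prim f" shows "prim (\<lambda>x. \<not> f x)"
proof -
  have "prim (\<lambda>x. if f x then False else True)" by (intro prim_basic assms)
  moreover have "(if a then False else True) = (\<not> a)" for a by simp
  ultimately show ?thesis by simp
qed

lemma prim_conj: assumes "prim f" "prim g" shows "prim (\<lambda>x. f x \<and> g x)"
proof -
  have "prim (\<lambda>x. if f x then g x else False)" by (intro prim_basic assms)
  moreover have "(if a then b else False) = (a \<and> b)" for a b by simp
  ultimately show ?thesis by simp
qed

lemma prim_disj: assumes "prim f" "prim g" shows "prim (\<lambda>x. f x \<or> g x)"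
proof -
  have "prim (\<lambda>x. if f x then True else g x)" by (intro prim_basic assms)
  moreover have "(if a then True else b) = (a \<or> b)" for a b by simp
  ultimately show ?thesis by simp
qed

lemma prim_imp: assumes "prim f" "prim g" shows "prim (\<lambda>x. f x \<longrightarrow> g x)"
  using prim_disj[OF prim_not[OF assms(1)] assms(2)] by simp

lemma prim_add: assumes "prim f" "prim g" shows "prim (\<lambda>x. f x + g x :: nat)"
proof -
  have "prim (\<lambda>x. rec_nat (f x) (\<lambda>_ r. Suc r) (g x))" by (intro prim_basic assms)
  moreover have "rec_nat a (\<lambda>_ r. Suc r) b = a + b" for a b by (induction b) auto
  ultimately show ?thesis by simp
qed

lemma prim_diff: assumes "prim f" "prim g" shows "prim (\<lambda>x. f x - g x :: nat)"
proof -
  have "prim (\<lambda>x. rec_nat (f x) (\<lambda>_ r. case r of 0 \<Rightarrow> 0 | Suc k \<Rightarrow> k) (g x))"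
    by (intro prim_basic assms)
  moreover have "rec_nat a (\<lambda>_ r. case r of 0 \<Rightarrow> 0 | Suc k \<Rightarrow> k) b = a - b" for a b
    by (induction b) (auto split: nat.splits)
  ultimately show ?thesis by simp
qed

lemma prim_eq: assumes "prim f" "prim g" shows "prim (\<lambda>x. f x = g x)"
proof -
  have "prim (\<lambda>x. case (enc (f x) - enc (g x)) + (enc (g x) - enc (f x)) of 0 \<Rightarrow> True | Suc _ \<Rightarrow> False)"
    by (intro prim_basic prim_add prim_diff assms)
  moreover have "(case (m - n) + (n - m) of 0 \<Rightarrow> True | Suc _ \<Rightarrow> False) = (m = n)" for m n :: nat
    by (auto split: nat.splits)
  ultimately show ?thesis by simp
qed

lemma prim_less: assumes "prim f" "prim g" shows "prim (\<lambda>x. f x < (g x :: nat))"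
proof -
  have "prim (\<lambda>x. \<not> g x - f x = 0)" by (intro prim_basic prim_not prim_eq prim_diff assms)
  then show ?thesis by (simp add: not_le)
qed

lemmas prim_arith = prim_basic prim_not prim_conj prim_disj prim_imp prim_add prim_diff prim_eq prim_less

lemma prim_odd: assumes "prim f" shows "prim (\<lambda>x. odd (f x :: nat))"
proof -
  have "prim (\<lambda>x. rec_nat False (\<lambda>_ b. \<not> b) (f x))" by (intro prim_arith assms)
  moreover have "rec_nat False (\<lambda>_ b. \<not> b) n = odd n" for n by (induction n) auto
  ultimately show ?thesis by simp
qed

lemma prim_half: assumes "prim f" shows "prim (\<lambda>x. f x div 2 :: nat)"
proof -
  have "prim (\<lambda>x. rec_nat 0 (\<lambda>k r. if odd k then Suc r else r) (f x))"
    by (intro prim_arith prim_odd assms)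
  moreover have "rec_nat 0 (\<lambda>k r. if odd k then Suc r else r) n = n div 2" for n
    by (induction n) auto
  ultimately show ?thesis by simp
qed

lemma prim_in_set_decode: assumes "prim f" "prim g" shows "prim (\<lambda>x. f x \<in> set_decode (g x))"
proof -
  have "prim (\<lambda>x. odd (rec_nat (g x) (\<lambda>_ r. r div 2) (f x)))"
    by (intro prim_arith prim_odd prim_half assms)
  moreover have "rec_nat m (\<lambda>_ r. r div 2) n = m div 2 ^ n" for m n :: nat
    by (induction n) (simp_all add: div_mult2_eq mult.commute[of 2])
  ultimately show ?thesis by (simp add: set_decode_def)
qed

lemma prim_mod3: assumes "prim f" shows "prim (\<lambda>x. f x mod 3 :: nat)"
proof -
  have "prim (\<lambda>x. rec_nat 0 (\<lambda>_ r. if r = 2 then 0 else Suc r) (f x))"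
    by (intro prim_arith assms)
  moreover have "rec_nat 0 (\<lambda>_ r. if r = 2 then 0 else Suc r) n = n mod 3" for n
    by (induction n) (auto simp: mod_Suc)
  ultimately show ?thesis by simp
qed

section \<open>Recursion over lists\<close>

lemma prim_foldl:
  assumes "prim l" "prim z" "prim (\<lambda>p. s (fst p) (fst (snd p)) (snd (snd p)))"
  shows "prim (\<lambda>x. foldl (s x) (z x) (l x))"
proof -
  \<comment> \<open>The state is the accumulator with the unread rest of the list. A step on an
    empty rest does nothing, so surplus rounds are harmless and the code of the list can serve as
    the number of rounds.\<close>
  define step where "step = (\<lambda>x st. case snd st of [] \<Rightarrow> st | y # ys \<Rightarrow> (s x (fst st) y, ys))"
  have "prim (\<lambda>x. fst (rec_nat (z x, l x) (\<lambda>_ st. step x st) (enc (l x))))"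
    unfolding step_def by (intro prim_basic prim3[OF assms(3)] assms)
  moreover have "fst (rec_nat (a, xs) (\<lambda>_ st. step x st) (enc xs)) = foldl (s x) a xs" for x a xs
  proof -
    have swap: "rec_nat a (\<lambda>_. h) (Suc n) = rec_nat (h a) (\<lambda>_. h) n" for h :: "'d \<Rightarrow> 'd" and a n
      by (induction n) auto
    have "rec_nat (a, []) (\<lambda>_. step x) n = (a, [])" for a n
      by (induction n) (auto simp: step_def)
    then have "length xs \<le> n \<Longrightarrow> fst (rec_nat (a, xs) (\<lambda>_. step x) n) = foldl (s x) a xs" for n
    proof (induction xs arbitrary: a n)
      case (Cons y ys)
      then obtain m where "n = Suc m" "length ys \<le> m" by (cases n) auto
      then show ?case using Cons.IH Cons.prems(2) by (simp add: swap step_def del: nat.rec(2))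
    qed simp
    then show ?thesis using length_le_enc by blast
  qed
  ultimately show ?thesis by simp
qed

lemma prim_rev: assumes "prim l" shows "prim (\<lambda>x. rev (l x))"
proof -
  have "prim (\<lambda>x. foldl (\<lambda>acc y. y # acc) [] (l x))" by (intro prim_arith prim_foldl assms)
  moreover have "foldl (\<lambda>acc y. y # acc) zs ys = rev ys @ zs" for ys zs :: "'b list"
    by (induction ys arbitrary: zs) auto
  ultimately show ?thesis by simp
qed

lemma prim_foldr:
  assumes "prim l" "prim z" "prim (\<lambda>p. s (fst p) (fst (snd p)) (snd (snd p)))"
  shows "prim (\<lambda>x. foldr (s x) (l x) (z x))"
  unfolding foldr_conv_foldl
  by (intro prim_foldl prim_rev assms prim3[OF assms(3)] prim_basic)

lemma prim_map:
  assumes "prim l" "prim (\<lambda>p. f (fst p) (snd p))"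
  shows "prim (\<lambda>x. map (f x) (l x))"
proof -
  have "prim (\<lambda>x. foldr (\<lambda>y acc. f x y # acc) (l x) [])"
    by (intro prim_foldr prim_basic assms prim2[OF assms(2)])
  moreover have "foldr (\<lambda>y acc. f x y # acc) ys [] = map (f x) ys" for x ys
    by (induction ys) auto
  ultimately show ?thesis by simp
qed

lemma prim_append: assumes "prim f" "prim g" shows "prim (\<lambda>x. f x @ g x)"
proof -
  have "prim (\<lambda>x. foldr (\<lambda>y acc. y # acc) (f x) (g x))"
    by (intro prim_foldr prim_basic assms)
  moreover have "foldr (\<lambda>y acc. y # acc) ys zs = ys @ zs" for ys zs :: "'b list" by (induction ys) auto
  ultimately show ?thesis by simp
qed

lemma prim_concat: assumes "prim f" shows "prim (\<lambda>x. concat (f x))"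
proof -
  have "prim (\<lambda>x. foldr (\<lambda>y acc. y @ acc) (f x) [])"
    by (intro prim_foldr prim_basic prim_append assms)
  then show ?thesis by (simp add: concat_conv_foldr)
qed

lemma prim_Ball:
  assumes "prim l" "prim (\<lambda>p. P (fst p) (snd p))"
  shows "prim (\<lambda>x. \<forall>y\<in>set (l x). P x y)"
proof -
  have "prim (\<lambda>x. foldr (\<lambda>y b. P x y \<and> b) (l x) True)"
    by (intro prim_foldr prim_arith assms prim2[OF assms(2)])
  moreover have "foldr (\<lambda>y b. P x y \<and> b) ys True = (\<forall>y\<in>set ys. P x y)" for x ys
    by (induction ys) auto
  ultimately show ?thesis by simp
qed

lemma prim_Bex:
  assumes "prim l" "prim (\<lambda>p. P (fst p) (snd p))"
  shows "prim (\<lambda>x. \<exists>y\<in>set (l x). P x y)"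
  using prim_not[OF prim_Ball[OF assms(1) prim_not[OF assms(2)]]] by simp

lemma prim_length: assumes "prim l" shows "prim (\<lambda>x. length (l x))"
proof -
  have "prim (\<lambda>x. foldr (\<lambda>y n. Suc n) (l x) 0)" by (intro prim_foldr prim_basic assms)
  moreover have "foldr (\<lambda>y n. Suc n) ys 0 = length ys" for ys :: "'b list" by (induction ys) auto
  ultimately show ?thesis by simp
qed

lemma prim_filter:
  assumes "prim l" "prim (\<lambda>p. P (fst p) (snd p))"
  shows "prim (\<lambda>x. filter (P x) (l x))"
proof -
  have "prim (\<lambda>x. foldr (\<lambda>y acc. if P x y then y # acc else acc) (l x) [])"
    by (intro prim_foldr prim_arith assms prim2[OF assms(2)])
  moreover have "foldr (\<lambda>y acc. if P x y then y # acc else acc) ys [] = filter (P x) ys" for x ys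
    by (induction ys) auto
  ultimately show ?thesis by simp
qed

lemma prim_map_of:
  fixes l :: "'a::encodable \<Rightarrow> ('b::encodable \<times> 'c::encodable) list"
  assumes "prim l" "prim k" shows "prim (\<lambda>x. map_of (l x) (k x))"
proof -
  have "prim (\<lambda>x. foldr (\<lambda>p acc. if fst p = k x then Some (snd p) else acc) (l x) None)"
    by (intro prim_foldr prim_arith assms prim_comp[OF assms(2)])
  moreover have "foldr (\<lambda>p acc. if fst p = j then Some (snd p) else acc) ys None = map_of ys j"
    for j and ys :: "('b \<times> 'c) list"
    by (induction ys) auto
  ultimately show ?thesis by simp
qed

lemma prim_upt: assumes "prim n" shows "prim (\<lambda>x. [0..<n x])"
proof -
  have "prim (\<lambda>x. rec_nat [] (\<lambda>k l. l @ [k]) (n x))" by (intro prim_basic prim_append assms)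
  moreover have "rec_nat [] (\<lambda>k l. l @ [k]) n = [0..<n]" for n by (induction n) auto
  ultimately show ?thesis by simp
qed

lemma prim_replicate: assumes "prim n" "prim f" shows "prim (\<lambda>x. replicate (n x) (f x))"
proof -
  have "prim (\<lambda>x. rec_nat [] (\<lambda>_ l. f x # l) (n x))"
    by (intro prim_basic assms prim_comp[OF assms(2)])
  moreover have "rec_nat [] (\<lambda>_ l. y # l) n = replicate n y" for n and y :: 'b by (induction n) auto
  ultimately show ?thesis by simp
qed

section \<open>Integers\<close>

lemma int_encode_of_nat: "int_encode (int n) = 2 * n"
  by (simp add: int_encode_def sum_encode_def)

lemma prim_int: assumes "prim f" shows "prim (\<lambda>x. int (f x))"
proof -
  have "prim (\<lambda>n. n + n :: nat)" by (intro prim_arith)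
  then obtain g where "looping g" "\<And>n. g n = n + n" by (elim primE) simp
  then have "prim int" by (intro primI[of g]) (simp_all add: int_encode_of_nat)
  then show ?thesis using assms by (rule prim_comp)
qed

text \<open>The codes of 0, 1, 2, ... are the even numbers and those of -1, -2, ... the odd ones. So
  a step by one moves the code by two, except between the code 1 of -1 and the code 0 of 0.\<close>

lemma prim_int_succ: assumes "prim f" shows "prim (\<lambda>x. f x + 1 :: int)"
proof -
  have "prim (\<lambda>m :: nat. if odd m then if m = 1 then 0 else m - 2 else m + 2)"
    by (intro prim_arith prim_odd)
  then obtain g where g: "looping g" "\<And>m. g m = (if odd m then if m = 1 then 0 else m - 2 else m + 2)"
    by (elim primE) simp
  have "int_encode (i + 1) = g (int_encode i)" for i
    unfolding g int_encode_def sum_encode_def by (auto simp: nat_add_distrib nat_diff_distrib)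
  then have "prim (\<lambda>i :: int. i + 1)" by (intro primI[OF g(1)]) simp
  then show ?thesis using assms by (rule prim_comp)
qed

lemma prim_int_pred: assumes "prim f" shows "prim (\<lambda>x. f x - 1 :: int)"
proof -
  have "prim (\<lambda>m :: nat. if odd m then m + 2 else if m = 0 then 1 else m - 2)"
    by (intro prim_arith prim_odd)
  then obtain g where g: "looping g" "\<And>m. g m = (if odd m then m + 2 else if m = 0 then 1 else m - 2)"
    by (elim primE) simp
  have "int_encode (i - 1) = g (int_encode i)" for i
    unfolding g int_encode_def sum_encode_def by (auto simp: nat_add_distrib nat_diff_distrib)
  then have "prim (\<lambda>i :: int. i - 1)" by (intro primI[OF g(1)]) simp
  then show ?thesis using assms by (rule prim_comp)
qed

lemma prim_minus_int: assumes "prim f" shows "prim (\<lambda>x. - int (f x))"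
proof -
  have "prim (\<lambda>x. rec_nat 0 (\<lambda>_ i. i - 1) (f x) :: int)" by (intro prim_basic prim_int_pred assms)
  moreover have "rec_nat 0 (\<lambda>_ i. i - 1) n = - int n" for n by (induction n) auto
  ultimately show ?thesis by simp
qed

lemmas prim_rules = prim_arith prim_odd prim_half prim_in_set_decode prim_mod3 prim_foldl prim_rev
  prim_foldr prim_map prim_append prim_concat prim_Ball prim_Bex prim_length prim_filter prim_map_of
  prim_upt prim_replicate prim_int prim_int_succ prim_int_pred prim_minus_int

lemma prim_decidable:
  assumes "prim (\<lambda>n :: nat. n \<in> A)" shows "decidable A"
proof -
  have "prim (\<lambda>n :: nat. enc (n \<in> A))" by (intro prim_enc assms)
  then have "looping (\<lambda>n. enc (n \<in> A))" by (rule prim_looping)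
  then have "computable (\<lambda>n. enc (n \<in> A))" by (rule looping_computable)
  then show ?thesis by (simp add: decidable_def of_bool_def)
qed

section \<open>Simulation of Turing machines\<close>

definition nth0 :: "nat list \<Rightarrow> nat \<Rightarrow> nat" where
  "nth0 xs k = (if k < length xs then xs ! k else 0)"

definition hd0 :: "nat list \<Rightarrow> nat" where
  "hd0 xs = (case xs of [] \<Rightarrow> 0 | a # _ \<Rightarrow> a)"

lemma nth0_Cons: "nth0 (a # xs) k = (case k of 0 \<Rightarrow> a | Suc j \<Rightarrow> nth0 xs j)"
  by (simp add: nth0_def split: nat.splits)

lemma nth0_tl: "nth0 (tl xs) k = nth0 xs (Suc k)"
  by (cases xs) (auto simp: nth0_def)

lemma hd0_eq_nth0: "hd0 xs = nth0 xs 0"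
  by (cases xs) (auto simp: nth0_def hd0_def)

text \<open>
  A configuration is simulated as the state, the cells to the left of the head read leftwards, and
  the cells from the head on read rightwards, up to trailing blanks.
\<close>

type_synonym zipper = "nat \<times> nat list \<times> nat list"

fun represents :: "zipper \<Rightarrow> tm_config \<Rightarrow> bool" where
  "represents (q, l, r) (q', h, t) \<longleftrightarrow>
     q = q' \<and> (\<forall>k. t (h + int k) = nth0 r k) \<and> (\<forall>k. t (h - 1 - int k) = nth0 l k)"

definition zrow :: "tm \<Rightarrow> zipper \<Rightarrow> (nat \<times> nat \<times> move) option" where
  "zrow M z = map_of M (fst z, hd0 (snd (snd z)))"

definition zact :: "nat \<times> nat \<times> move \<Rightarrow> nat list \<Rightarrow> nat list \<Rightarrow> zipper" where
  "zact a l r = (fst a,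
     if snd (snd a) = Move_Left then (tl l, hd0 l # fst (snd a) # tl r)
     else if snd (snd a) = Stay then (l, fst (snd a) # tl r)
     else (fst (snd a) # l, tl r))"

text \<open>A halted zipper is its own successor. So the run is defined at every time bound, and an
  \<open>outcome\<close> once reached no longer changes.\<close>

definition zstep :: "tm \<Rightarrow> zipper \<Rightarrow> zipper" where
  "zstep M z = (case zrow M z of None \<Rightarrow> z | Some a \<Rightarrow> zact a (fst (snd z)) (snd (snd z)))"

definition zrun :: "tm \<Rightarrow> nat \<Rightarrow> nat \<Rightarrow> zipper" where
  "zrun M n s = rec_nat (0, [], replicate n 1) (\<lambda>_ z. zstep M z) s"

definition outcome :: "tm \<Rightarrow> nat \<Rightarrow> nat \<Rightarrow> nat option" where
  "outcome M n s = (case zrow M (zrun M n s) of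
     None \<Rightarrow> Some (length (filter (\<lambda>a. a = 1) (fst (snd (zrun M n s)))) +
                   length (filter (\<lambda>a. a = 1) (snd (snd (zrun M n s)))))
   | Some _ \<Rightarrow> None)"

lemma represents_row: "represents z (q, h, t) \<Longrightarrow> zrow M z = map_of M (q, t h)"
  by (cases z) (auto simp: zrow_def hd0_eq_nth0 dest: spec[of _ 0])

lemma represents_act:
  assumes "represents (q, l, r) (q, h, t)"
  shows "represents (zact (q', b, m) l r) (q', h + displacement m, t(h := b))"
proof -
  have r: "t (h + int k) = nth0 r k" and l: "t (h - 1 - int k) = nth0 l k" for k
    using assms by auto
  have r': "t (h + (1 + int k)) = nth0 r (Suc k)" and l': "t (h - (2 + int k)) = nth0 l (Suc k)"
    "t (h - 1) = nth0 l 0" for k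
    using r[of "Suc k"] l[of "Suc k"] l[of 0] by (simp_all add: algebra_simps)
  show ?thesis
  proof (cases m)
    case Move_Left
    have "(t(h := b)) (h - 1 + int k) = nth0 (hd0 l # b # tl r) k" for k
    proof (cases k)
      case (Suc j)
      then show ?thesis using r'(1)[of "j - 1"]
        by (cases j) (simp_all add: nth0_Cons nth0_tl algebra_simps)
    qed (simp add: nth0_Cons hd0_eq_nth0 l'(2))
    moreover have "(t(h := b)) (h - 1 - 1 - int k) = nth0 (tl l) k" for k
      using l'(1)[of k] by (simp add: nth0_tl algebra_simps)
    ultimately show ?thesis using Move_Left by (simp add: zact_def)
  next
    case Stay
    have "(t(h := b)) (h + int k) = nth0 (b # tl r) k" for k
      using r'(1)[of "k - 1"] by (cases k) (simp_all add: nth0_Cons nth0_tl)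
    then show ?thesis using Stay l by (simp add: zact_def)
  next
    case Move_Right
    have "(t(h := b)) (h + 1 + int k) = nth0 (tl r) k" for k
      using r'(1)[of k] by (simp add: nth0_tl algebra_simps)
    moreover have "(t(h := b)) (h + 1 - 1 - int k) = nth0 (b # l) k" for k
      using l[of "k - 1"] by (cases k) (simp_all add: nth0_Cons algebra_simps)
    ultimately show ?thesis using Move_Right by (simp add: zact_def)
  qed
qed

lemma represents_moves:
  assumes "represents z c" "moves M c c'"
  shows "represents (zstep M z) c'"
proof -
  obtain q l r h t where z: "z = (q, l, r)" "c = (q, h, t)"
    using assms(1) by (cases z; cases c) auto
  obtain q' b m where m: "map_of M (q, t h) = Some (q', b, m)" "c' = (q', h + displacement m, t(h := b))"
    using assms(2) z(2) moves_iff by blast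
  show ?thesis
    using represents_act[of q l r h t q' b m] represents_row[of z q h t M] assms(1) m z
    by (simp add: zstep_def)
qed

lemma represents_initial: "represents (0, [], replicate n 1) (tm_initial n)"
  by (auto simp: tm_initial_def nth0_def)

lemma reaches_zrun: "reaches M (tm_initial n) c \<Longrightarrow> \<exists>s. represents (zrun M n s) c"
proof (induction rule: rtranclp_induct)
  case base
  have "represents (zrun M n 0) (tm_initial n)" using represents_initial by (simp add: zrun_def)
  then show ?case ..
next
  case (step c c')
  then obtain s where "represents (zrun M n s) c" by blast
  from represents_moves[OF this step(2)] have "represents (zrun M n (Suc s)) c'"
    by (simp add: zrun_def)
  then show ?case ..
qed

lemma zrun_reaches: "\<exists>c. reaches M (tm_initial n) c \<and> represents (zrun M n s) c"
proof (induction s)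
  case 0
  have "represents (zrun M n 0) (tm_initial n)" using represents_initial by (simp add: zrun_def)
  then show ?case by blast
next
  case (Suc s)
  then obtain q h t where c: "reaches M (tm_initial n) (q, h, t)" "represents (zrun M n s) (q, h, t)"
    by (metis prod_cases3)
  show ?case
  proof (cases "map_of M (q, t h)")
    case None
    then have "zrun M n (Suc s) = zrun M n s"
      using represents_row[OF c(2), of M] by (simp add: zrun_def zstep_def)
    then show ?thesis using c by auto
  next
    case (Some a)
    then obtain c' where m: "moves M (q, h, t) c'"
      by (cases a) (auto simp: moves_iff)
    from represents_moves[OF c(2) m] have "represents (zrun M n (Suc s)) c'"
      by (simp add: zrun_def)
    then show ?thesis using reaches_move[OF c(1) m] by blast
  qed
qed

text \<open>The blank 0 is not counted, so cells beyond the two lists contribute nothing, however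
  many trailing blanks the lists keep.\<close>

lemma represents_card:
  assumes "represents (q, l, r) (q, h, t)"
  shows "card {i. t i = 1} = length (filter (\<lambda>a. a = 1) l) + length (filter (\<lambda>a. a = 1) r)"
proof -
  have r: "t (h + int k) = nth0 r k" and l: "t (h - 1 - int k) = nth0 l k" for k
    using assms by auto
  have "length (filter (\<lambda>a. a = 1) xs) = card {k. nth0 xs k = 1}" for xs
    unfolding length_filter_conv_card by (rule arg_cong[where f = card]) (auto simp: nth0_def)
  moreover have "finite {k. nth0 xs k = 1}" for xs
    by (rule finite_subset[of _ "{..<length xs}"]) (auto simp: nth0_def split: if_splits)
  moreover have "{i. t i = 1} = (\<lambda>k. h - 1 - int k) ` {k. nth0 l k = 1} \<union> (\<lambda>k. h + int k) ` {k. nth0 r k = 1}"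
  proof (intro set_eqI iffI)
    fix i assume i: "i \<in> {i. t i = 1}"
    show "i \<in> (\<lambda>k. h - 1 - int k) ` {k. nth0 l k = 1} \<union> (\<lambda>k. h + int k) ` {k. nth0 r k = 1}"
    proof (cases "i < h")
      case True
      then have "i = h - 1 - int (nat (h - 1 - i))" by simp
      then obtain k where "i = h - 1 - int k" ..
      then show ?thesis using i l[of k] by simp
    next
      case False
      then have "i = h + int (nat (i - h))" by simp
      then obtain k where "i = h + int k" ..
      then show ?thesis using i r[of k] by simp
    qed
  qed (auto simp: r l)
  moreover have "(\<lambda>k. h - 1 - int k) ` A \<inter> (\<lambda>k. h + int k) ` B = {}" for A B by auto
  ultimately show ?thesis by (simp add: card_Un_disjoint card_image inj_on_def)
qed

text \<open>Kleene's normal form: runs of arbitrary machines become a primitive recursive function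
  of machine, input and time bound, and only the time bound is searched.\<close>

theorem tm_computes_iff_outcome: "tm_computes M n v \<longleftrightarrow> (\<exists>s. outcome M n s = Some v)"
proof
  assume "tm_computes M n v"
  then obtain q h t where c: "reaches M (tm_initial n) (q, h, t)" "map_of M (q, t h) = None"
    "v = card {i. t i = 1}"
    unfolding tm_computes_iff by blast
  obtain s where s: "represents (zrun M n s) (q, h, t)" using reaches_zrun[OF c(1)] by blast
  then have "outcome M n s = Some v"
    using c represents_row[OF s, of M] represents_card[of q "fst (snd (zrun M n s))" "snd (snd (zrun M n s))" h t]
    by (cases "zrun M n s") (simp add: outcome_def)
  then show "\<exists>s. outcome M n s = Some v" ..
next
  assume "\<exists>s. outcome M n s = Some v"
  then obtain s where s: "outcome M n s = Some v" by blast
  obtain q h t where c: "reaches M (tm_initial n) (q, h, t)" "represents (zrun M n s) (q, h, t)"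
    using zrun_reaches by (metis prod_cases3)
  have "map_of M (q, t h) = None"
    using s represents_row[OF c(2), of M] by (auto simp: outcome_def split: option.splits)
  moreover have "v = card {i. t i = 1}"
    using s c(2) represents_card[of q "fst (snd (zrun M n s))" "snd (snd (zrun M n s))" h t]
    by (cases "zrun M n s") (auto simp: outcome_def split: option.splits)
  ultimately show "tm_computes M n v" unfolding tm_computes_iff using c(1) by blast
qed

lemma moves_deterministic: "moves M a b \<Longrightarrow> moves M a c \<Longrightarrow> b = c"
  by (simp add: moves_def)

lemma tm_computes_deterministic: "tm_computes M n v \<Longrightarrow> tm_computes M n w \<Longrightarrow> v = w"
proof -
  have mono: "outcome M n (s + k) = Some v" if "outcome M n s = Some v" for s k v
    using that
    by (induction k) (auto simp: outcome_def zrun_def zstep_def split: option.splits)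
  show "tm_computes M n v \<Longrightarrow> tm_computes M n w \<Longrightarrow> v = w"
    unfolding tm_computes_iff_outcome using mono by (metis add.commute option.inject)
qed

lemma prim_tl: assumes "prim f" shows "prim (\<lambda>x. tl (f x))"
proof -
  have "prim (\<lambda>x. case f x of [] \<Rightarrow> [] | y # ys \<Rightarrow> ys)" by (intro prim_rules assms)
  then show ?thesis by (simp add: tl_def)
qed

lemma prim_hd0: assumes "prim f" shows "prim (\<lambda>x. hd0 (f x))"
  unfolding hd0_def by (intro prim_rules assms)

lemma prim_zrow: assumes "prim f" "prim g" shows "prim (\<lambda>x. zrow (f x) (g x))"
  unfolding zrow_def by (intro prim_rules prim_hd0 assms)

lemma prim_zrun:
  assumes "prim f" "prim g" "prim h" shows "prim (\<lambda>x. zrun (f x) (g x) (h x))"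
  unfolding zrun_def zstep_def zact_def
  by (intro prim_rules prim_hd0 prim_tl prim_zrow assms prim_comp[OF assms(1)])

lemma prim_outcome:
  assumes "prim f" "prim g" "prim h" shows "prim (\<lambda>x. outcome (f x) (g x) (h x))"
  unfolding outcome_def
  by (intro prim_rules prim_zrow prim_zrun assms)

lemma prim_prod_decode: assumes "prim f" shows "prim (\<lambda>x. prod_decode (f x))"
proof -
  have "prim prod_decode" by (rule primI[OF looping_id]) (simp add: enc_prod_def)
  then show ?thesis using assms by (rule prim_comp)
qed

lemma prim_list_decode: assumes "prim f" shows "prim (\<lambda>x. list_decode (f x))"
proof -
  have "map enc ns = ns" for ns :: "nat list" by (rule map_idI) simp
  then have "prim list_decode" by (intro primI[OF looping_id]) (simp add: enc_list_def)
  then show ?thesis using assms by (rule prim_comp)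
qed

lemma prim_tm_decode: assumes "prim f" shows "prim (\<lambda>x. tm_decode (f x))"
  unfolding tm_decode_def transition_decode_def move_decode_def Let_def case_prod_unfold
  by (intro prim_rules prim_prod_decode prim_list_decode assms)

lemma tm_decode_enc: "tm_decode (enc M) = M"
proof -
  have "move_decode (enc m) = m" for m
    by (cases m) (simp_all add: enc_move_def move_decode_def)
  then have "transition_decode (enc r) = r" for r
    by (cases r) (simp add: transition_decode_def enc_prod_def)
  then show ?thesis by (simp add: tm_decode_def enc_list_def comp_def)
qed

section \<open>Halting and unbounded search\<close>

definition halts :: "tm \<Rightarrow> nat \<Rightarrow> bool" where
  "halts M n \<longleftrightarrow> (\<exists>c. reaches M (tm_initial n) c \<and> tm_step M c = None)"

lemma halts_iff:
  "halts M n \<longleftrightarrow> (\<exists>q h t. reaches M (tm_initial n) (q, h, t) \<and> map_of M (q, t h) = None)"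
proof -
  have "tm_step M (q, h, t) = None \<longleftrightarrow> map_of M (q, t h) = None" for q h t
    by (cases "map_of M (q, t h)") auto
  then show ?thesis unfolding halts_def split_paired_Ex by presburger
qed

text \<open>By determinism the nonempty run from \<open>a\<close> to \<open>b\<close> is an initial
  segment of the halting run from \<open>a\<close>. An endless chain of such runs thus excludes
  halting.\<close>

lemma halting_descent:
  assumes "reaches1 M a b" "(moves M ^^ N) a c" "tm_step M c = None"
  shows "\<exists>N'<N. (moves M ^^ N') b c"
  using assms(1,2)
proof (induction arbitrary: N rule: converse_tranclp_induct)
  case (base a)
  then obtain N' where N: "N = Suc N'" using assms(3) by (cases N) (auto simp: moves_def)
  then obtain a' where "moves M a a'" "(moves M ^^ N') a' c"
    using base relpowp_Suc_E2[of N' "moves M" a c] by blast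
  then show ?case using moves_deterministic base(1) N by blast
next
  case (step a a')
  then obtain N' where N: "N = Suc N'" using assms(3) by (cases N) (auto simp: moves_def)
  then obtain b' where "moves M a b'" "(moves M ^^ N') b' c"
    using step.prems relpowp_Suc_E2[of N' "moves M" a c] by blast
  then have "(moves M ^^ N') a' c" using moves_deterministic step(1) by blast
  from step.IH[OF this] N show ?case using less_Suc_eq by blast
qed

text \<open>
  The program \<open>Loop 0 c\<close> is not well-formed, since its body sets the counter anew. So its machine
  need not terminate, and it is analysed without \<open>exec\<close>.
\<close>

theorem search_machine:
  assumes "looping g"
  obtains M where "\<And>m. halts M m \<longleftrightarrow> (\<exists>k. (case_nat 0 g ^^ k) m = 0)"
proof -
  \<comment> \<open>One round takes the register from \<open>Suc w\<close> to \<open>g w\<close>, as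
    the test lowers it to \<open>w\<close> before the body runs. The value 0 means exit and is
    absorbing in \<open>?G\<close>.\<close>
  let ?G = "case_nat 0 g"
  obtain c where c: "implements c 0 g" using assms unfolding looping_def by blast
  let ?c = "Loop 0 c"
  define K where "K = Suc (Suc (Max (regs ?c)))"
  have K: "2 \<le> K" "regs ?c \<subseteq> {..<K}"
    using Max_ge[OF finite_regs[of ?c]]
    by (auto simp: K_def simp del: regs.simps intro: le_less_trans[of _ "Max (regs ?c)"])
  let ?M = "machine K ?c 0"
  have body: "map_of ?M (q, a) = delta K ?c 2 q a" if "2 \<le> q" "q < 2 + csize ?c" "a \<le> 2 ^ K" for q a
    using map_of_machine_body that by blast
  have test: "reaches1 ?M (2, -1, tape K \<sigma>) (if \<sigma> 0 = 0 then (2 + csize ?c, -1, tape K \<sigma>)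
      else (2 + 4, -1, tape K (\<sigma>(0 := \<sigma> 0 - 1))))" for \<sigma>
    using K(1) by (intro loop_test body) auto
  have stop: "tm_step ?M (2 + csize ?c, h, t) = None" for h t
    using map_of_machine_halt[of K ?c 0] by simp
  have exit: "reaches ?M (2, -1, tape K (input 0 0)) (2 + csize ?c, -1, tape K (input 0 0))"
    using test[of "input 0 0"] by (simp add: tranclp_into_rtranclp)
  have round: "reaches1 ?M (2, -1, tape K (input (Suc w) 0)) (2, -1, tape K (input (g w) 0))" for w
  proof -
    have "(input (Suc w) 0)(0 := input (Suc w) 0 0 - 1) = input w 0" by auto
    then have 1: "reaches1 ?M (2, -1, tape K (input (Suc w) 0)) (6, -1, tape K (input w 0))"
      using test[of "input (Suc w) 0"] by simp
    have "reaches ?M (6, -1, tape K (input w 0)) (6 + csize c, -1, tape K (exec c (input w 0)))"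
      using K implementsD(1)[OF c] body by (intro delta_exec) auto
    moreover have "exec c (input w 0) = input (g w) 0"
      by (subst implementsD(3)[OF c]) (auto simp: clean_def)
    ultimately have 2: "reaches ?M (6, -1, tape K (input w 0)) (6 + csize c, -1, tape K (input (g w) 0))"
      by simp
    have 3: "moves ?M (6 + csize c, -1, tape K (input (g w) 0)) (2, -1, tape K (input (g w) 0))"
      using loop_back[of 2 0 c K ?M, OF body] by simp
    from reaches1_reaches[OF 1 reaches_move[OF 2 3]] show ?thesis .
  qed
  have halt0: "\<exists>e. reaches ?M (2, -1, tape K (input 0 0)) e \<and> tm_step ?M e = None"
    using exit stop by blast
  have halt: "\<exists>e. reaches ?M (2, -1, tape K (input m 0)) e \<and> tm_step ?M e = None"
    if "(?G ^^ k) m = 0" for k m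
    using that
  proof (induction k arbitrary: m)
    case 0
    then have m: "m = 0" by simp
    show ?case unfolding m by (rule halt0)
  next
    case (Suc k)
    show ?case
    proof (cases m)
      case m: 0
      show ?thesis unfolding m by (rule halt0)
    next
      case (Suc w)
      with Suc.prems have "(?G ^^ k) (g w) = 0" by (simp add: funpow_swap1)
      from Suc.IH[OF this] show ?thesis
        using reaches_trans[OF tranclp_into_rtranclp[OF round[of w]]] Suc by blast
    qed
  qed
  \<comment> \<open>If the value never becomes 0, each round would leave a strictly shorter halting
    run for the next one: descent on \<open>N\<close>.\<close>
  have diverge: "\<not> (moves ?M ^^ N) (2, -1, tape K (input m 0)) e"
    if "\<And>k. (?G ^^ k) m \<noteq> 0" "tm_step ?M e = None" for N m e
    using that
  proof (induction N arbitrary: m rule: less_induct)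
    case (less N)
    obtain w where m: "m = Suc w" using less.prems(1)[of 0] by (cases m) auto
    have gw: "(?G ^^ k) (g w) \<noteq> 0" for k
      using less.prems(1)[of "Suc k"] by (simp add: m funpow_swap1)
    show ?case
    proof
      assume "(moves ?M ^^ N) (2, -1, tape K (input m 0)) e"
      from halting_descent[OF round[of w] this[unfolded m] less.prems(2)]
      show False using less.IH[OF _ gw less.prems(2)] by blast
    qed
  qed
  show ?thesis
  proof (rule that[of ?M], rule iffI)
    fix m
    assume "\<exists>k. (?G ^^ k) m = 0"
    then obtain k where "(?G ^^ k) m = 0" ..
    from halt[OF this] show "halts ?M m"
      unfolding halts_def using reaches_trans[OF machine_start[OF K(1), of ?c 0 m]] by blast
  next
    fix m
    assume "halts ?M m"
    then obtain e where e: "reaches ?M (tm_initial m) e" "tm_step ?M e = None"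
      unfolding halts_def by blast
    obtain N where N: "(moves ?M ^^ N) (tm_initial m) e" using e(1) rtranclp_imp_relpowp by metis
    show "\<exists>k. (?G ^^ k) m = 0"
    proof (rule ccontr)
      assume "\<nexists>k. (?G ^^ k) m = 0"
      then have "\<And>k. (?G ^^ k) m \<noteq> 0" by simp
      then have d: "\<not> (moves ?M ^^ N) (2, -1, tape K (input m 0)) e" for N
        using e(2) by (rule diverge)
      \<comment> \<open>State 0 is not state 2, so at least one step has been made, as the descent
        requires.\<close>
      have "reaches1 ?M (tm_initial m) (2, -1, tape K (input m 0))"
        using rtranclpD[OF machine_start[OF K(1), of ?c 0 m]] by (auto simp: tm_initial_def)
      from halting_descent[OF this N e(2)] d show False by blast
    qed
  qed
qed

section \<open>Nearest-neighbour shifts\<close>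

text \<open>Neighbours are written as case distinctions on lists, a form that
  \<open>prim_rules\<close> covers once \<open>prim_refuted\<close> unfolds it.\<close>

definition west :: "int list \<Rightarrow> int list" where
  "west v = (case v of [] \<Rightarrow> [] | a # w \<Rightarrow> (a - 1) # w)"

definition east :: "int list \<Rightarrow> int list" where
  "east v = (case v of [] \<Rightarrow> [] | a # w \<Rightarrow> (a + 1) # w)"

definition north :: "int list \<Rightarrow> int list" where
  "north v = (case v of [] \<Rightarrow> [] | a # w \<Rightarrow> a # (case w of [] \<Rightarrow> [] | b # w' \<Rightarrow> (b + 1) # w'))"

definition window :: "(int list \<Rightarrow> nat) \<Rightarrow> int list \<Rightarrow> nat \<times> nat \<times> nat \<times> nat" where
  "window x v = (x (west v), x v, x (east v), x (north v))"

text \<open>Windows extend along the first two coordinates only, so the two-dimensional slices are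
  filled independently of each other. This treats all dimensions from 2 on alike.\<close>

definition window_shift :: "nat \<Rightarrow> nat \<Rightarrow> (nat \<times> nat \<times> nat \<times> nat) list \<Rightarrow> (int list \<Rightarrow> nat) set" where
  "window_shift d C L = {x \<in> Zd d \<rightarrow>\<^sub>E {..<C}. \<forall>v\<in>Zd d. window x v \<notin> set L}"

lemma neighbour_Zd [simp]:
  "west v \<in> Zd d \<longleftrightarrow> v \<in> Zd d" "east v \<in> Zd d \<longleftrightarrow> v \<in> Zd d" "north v \<in> Zd d \<longleftrightarrow> v \<in> Zd d"
  by (auto simp: Zd_def west_def east_def north_def split: list.splits)

lemma vadd_Zd: "u \<in> Zd d \<Longrightarrow> v \<in> Zd d \<Longrightarrow> vadd u v \<in> Zd d"
  by (simp add: Zd_def vadd_def)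

lemma vadd_zero: "length u = k \<Longrightarrow> vadd u (replicate k 0) = u"
  by (induction u arbitrary: k) (auto simp: vadd_def)

lemma vadd_Cons: "vadd (a # u) (b # v) = (a + b) # vadd u v"
  by (simp add: vadd_def)

lemma vadd_west: "u \<in> Zd d \<Longrightarrow> v \<in> Zd d \<Longrightarrow> vadd u (west v) = west (vadd u v)"
  by (cases u; cases v) (auto simp: Zd_def vadd_def west_def)

lemma vadd_east: "u \<in> Zd d \<Longrightarrow> v \<in> Zd d \<Longrightarrow> vadd u (east v) = east (vadd u v)"
  by (cases u; cases v) (auto simp: Zd_def vadd_def east_def)

lemma vadd_north: "u \<in> Zd d \<Longrightarrow> v \<in> Zd d \<Longrightarrow> vadd u (north v) = north (vadd u v)"
  by (cases u; cases "tl u"; cases v; cases "tl v") (auto simp: Zd_def vadd_def north_def)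

lemma Zd_Suc2E:
  assumes "v \<in> Zd (Suc (Suc k))"
  obtains a b w where "v = a # b # w" "length w = k"
  using assms by (auto simp: Zd_def length_Suc_conv)

definition window_pattern :: "nat \<Rightarrow> nat \<times> nat \<times> nat \<times> nat \<Rightarrow> pattern" where
  "window_pattern k = (\<lambda>(w, c, e, n).
     [-1 # 0 # replicate k 0 \<mapsto> w, 0 # 0 # replicate k 0 \<mapsto> c,
      1 # 0 # replicate k 0 \<mapsto> e, 0 # 1 # replicate k 0 \<mapsto> n])"

lemma window_pattern_appears:
  "appears_in (Suc (Suc k)) (window_pattern k q) x \<longleftrightarrow> (\<exists>v\<in>Zd (Suc (Suc k)). window x v = q)"
proof -
  obtain w c e n where q: "q = (w, c, e, n)" by (cases q)
  have "(\<forall>s\<in>dom (window_pattern k q). window_pattern k q s = Some (x (vadd v s))) \<longleftrightarrow> window x v = q"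
    if v: "v \<in> Zd (Suc (Suc k))" for v
  proof -
    obtain a b u where "v = a # b # u" "length u = k" using v by (rule Zd_Suc2E)
    then show ?thesis
      by (auto simp: q window_pattern_def window_def west_def east_def north_def vadd_Cons vadd_zero)
  qed
  then show ?thesis unfolding appears_in_def by auto
qed

theorem sft_window_shift: "sft (Suc (Suc k)) (window_shift (Suc (Suc k)) C L)"
proof -
  let ?d = "Suc (Suc k)"
  \<comment> \<open>A forbidden pattern has to be over the alphabet, so windows with other symbols
    are dropped; none of them can occur.\<close>
  define L' where "L' = {(w, c, e, n) \<in> set L. w < C \<and> c < C \<and> e < C \<and> n < C}"
  let ?F = "window_pattern k ` L'"
  have "finite ?F"
    unfolding L'_def by (intro finite_imageI finite_subset[OF _ finite_set[of L]]) auto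
  moreover have "\<forall>p\<in>?F. is_pattern ?d {..<C} p"
    by (auto simp: L'_def window_pattern_def is_pattern_def Zd_def ran_def split: if_splits)
  moreover have "window_shift ?d C L = subshift ?d {..<C} ?F"
  proof -
    have "(\<forall>v\<in>Zd ?d. window x v \<notin> set L) \<longleftrightarrow> (\<forall>p\<in>?F. \<not> appears_in ?d p x)"
      if x: "x \<in> Zd ?d \<rightarrow>\<^sub>E {..<C}" for x
    proof -
      have "x v < C" if "v \<in> Zd ?d" for v using PiE_mem[OF x that] by simp
      then have "window x v \<in> set L \<longleftrightarrow> window x v \<in> L'" if "v \<in> Zd ?d" for v
        using that by (simp add: window_def L'_def)
      then show ?thesis by (auto simp: window_pattern_appears)
    qed
    then show ?thesis unfolding window_shift_def subshift_def by blast
  qed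
  ultimately show ?thesis unfolding sft_def by blast
qed

text \<open>Window shifts are invariant under translation, so an occurrence can be moved to the
  origin. The premise expresses that \<open>p\<close> lives on \<open>Zd d\<close>.\<close>

lemma appears_in_window_shift:
  assumes "p = (\<lambda>s. if s \<in> Zd d then p s else None)"
  shows "(\<exists>x\<in>window_shift d C L. appears_in d p x)
    \<longleftrightarrow> (\<exists>x\<in>window_shift d C L. \<forall>s\<in>dom p. p s = Some (x s))"
proof
  assume "\<exists>x\<in>window_shift d C L. appears_in d p x"
  then obtain x u where x: "x \<in> window_shift d C L" "u \<in> Zd d" "\<forall>s\<in>dom p. p s = Some (x (vadd u s))"
    unfolding appears_in_def by blast
  define y where "y = (\<lambda>s\<in>Zd d. x (vadd u s))"
  have "window y v = window x (vadd u v)" if "v \<in> Zd d" for v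
    using that x(2) by (simp add: window_def y_def vadd_west vadd_east vadd_north)
  then have "y \<in> window_shift d C L"
    using x vadd_Zd[OF x(2)] unfolding window_shift_def by (auto simp: y_def PiE_iff)
  moreover have "dom p \<subseteq> Zd d" by (subst assms) (auto split: if_splits)
  then have "\<forall>s\<in>dom p. p s = Some (y s)" using x(3) by (auto simp: y_def)
  ultimately show "\<exists>x\<in>window_shift d C L. \<forall>s\<in>dom p. p s = Some (x s)" by blast
next
  assume "\<exists>x\<in>window_shift d C L. \<forall>s\<in>dom p. p s = Some (x s)"
  then obtain x where x: "x \<in> window_shift d C L" "\<forall>s\<in>dom p. p s = Some (x s)" by blast
  have "vadd (replicate d 0) s = s" if "length s = d" for s
    using that by (induction s arbitrary: d) (auto simp: vadd_def)
  moreover have "dom p \<subseteq> Zd d" by (subst assms) (auto split: if_splits)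
  ultimately have "appears_in d p x"
    using x(2) unfolding appears_in_def by (intro bexI[of _ "replicate d 0"]) (auto simp: Zd_def)
  then show "\<exists>x\<in>window_shift d C L. appears_in d p x" using x(1) by blast
qed

section \<open>Compactness by fillings of finite boxes\<close>

definition box :: "nat \<Rightarrow> nat \<Rightarrow> int list set" where
  "box d N = {v \<in> Zd d. \<forall>i\<in>set v. \<bar>i\<bar> \<le> int N}"

definition fills :: "nat \<Rightarrow> nat \<Rightarrow> (nat \<times> nat \<times> nat \<times> nat) list \<Rightarrow> pattern \<Rightarrow> nat \<Rightarrow> (int list \<Rightarrow> nat) \<Rightarrow> bool" where
  "fills d C L p N f \<longleftrightarrow>
     (\<forall>v\<in>box d N. f v < C \<and> (\<forall>a. p v = Some a \<longrightarrow> f v = a)) \<and>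
     (\<forall>v\<in>box d N. west v \<in> box d N \<longrightarrow> east v \<in> box d N \<longrightarrow> north v \<in> box d N \<longrightarrow> window f v \<notin> set L)"

lemma box_mono: "N \<le> N' \<Longrightarrow> box d N \<subseteq> box d N'"
  unfolding box_def by force

lemma in_some_box: "v \<in> Zd d \<Longrightarrow> \<exists>N. v \<in> box d N"
proof (intro exI)
  assume "v \<in> Zd d"
  have "\<bar>i\<bar> \<le> int (nat (\<Sum>i\<leftarrow>v. \<bar>i\<bar>))" if "i \<in> set v" for i
  proof -
    have "\<bar>i\<bar> \<le> (\<Sum>i\<leftarrow>v. \<bar>i\<bar>)"
      using that by (intro member_le_sum_list) auto
    moreover from this have "0 \<le> (\<Sum>i\<leftarrow>v. \<bar>i\<bar>)" by (rule order_trans[OF abs_ge_zero])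
    ultimately show ?thesis by simp
  qed
  with \<open>v \<in> Zd d\<close> show "v \<in> box d (nat (\<Sum>i\<leftarrow>v. \<bar>i\<bar>))" by (simp add: box_def)
qed

lemma fills_mono: "fills d C L p N' f \<Longrightarrow> N \<le> N' \<Longrightarrow> fills d C L p N f"
  unfolding fills_def using box_mono[of N N' d] by blast

text \<open>
  For the converse, the values of the cells are fixed one by one, in the order of their codes, such
  that every box still has a filling.
\<close>

theorem window_shift_compact:
  "(\<exists>x\<in>window_shift d C L. \<forall>s\<in>dom p \<inter> Zd d. p s = Some (x s)) \<longleftrightarrow> (\<forall>N. \<exists>f. fills d C L p N f)"
proof
  assume "\<exists>x\<in>window_shift d C L. \<forall>s\<in>dom p \<inter> Zd d. p s = Some (x s)"
  then obtain x where x: "x \<in> window_shift d C L" "\<forall>s\<in>dom p \<inter> Zd d. p s = Some (x s)" by blast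
  have "x v < C" if "v \<in> Zd d" for v
    using x(1) that unfolding window_shift_def by (auto dest: PiE_mem)
  moreover have "x v = a" if "v \<in> Zd d" "p v = Some a" for v a
    using x(2) that by (metis IntI domI option.inject)
  moreover have "window x v \<notin> set L" if "v \<in> Zd d" for v
    using x(1) that unfolding window_shift_def by blast
  ultimately have "fills d C L p N x" for N
    unfolding fills_def box_def by blast
  then show "\<forall>N. \<exists>f. fills d C L p N f" by blast
next
  assume fills: "\<forall>N. \<exists>f. fills d C L p N f"
  define cell where "cell = (\<lambda>j. map int_decode (list_decode j))"
  define index where "index = (\<lambda>v. list_encode (map int_encode v))"
  have cell_index: "cell (index v) = v" for v
    by (simp add: cell_def index_def comp_def)
  have index_cell: "index (cell j) = j" for j
    by (simp add: cell_def index_def comp_def)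
  define good where "good = (\<lambda>m g. \<forall>N. \<exists>f. fills d C L p N f \<and> (\<forall>j<m. cell j \<in> box d N \<longrightarrow> f (cell j) = g (cell j)))"
  have extend: "\<exists>c. good (Suc m) (g(cell m := c))" if g: "good m g" for m g
  proof (rule ccontr)
    \<comment> \<open>Pigeonhole: if each value \<open>c\<close> failed on some box
      \<open>B c\<close>, a box containing all of these would still have a filling that agrees with
      \<open>g\<close>, and its value at the new cell would be one of the \<open>c\<close>.\<close>
    assume "\<nexists>c. good (Suc m) (g(cell m := c))"
    then have "\<forall>c. \<exists>N. \<forall>f. fills d C L p N f \<longrightarrow>
        \<not> (\<forall>j<Suc m. cell j \<in> box d N \<longrightarrow> f (cell j) = (g(cell m := c)) (cell j))"
      unfolding good_def by blast
    then obtain B where B: "\<And>c f. fills d C L p (B c) f \<Longrightarrow>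
        \<not> (\<forall>j<Suc m. cell j \<in> box d (B c) \<longrightarrow> f (cell j) = (g(cell m := c)) (cell j))"
      by metis
    obtain N0 where N0: "cell m \<in> Zd d \<Longrightarrow> cell m \<in> box d N0" using in_some_box by blast
    define N where "N = N0 + (\<Sum>c\<le>C. B c)"
    obtain f where f: "fills d C L p N f" "\<forall>j<m. cell j \<in> box d N \<longrightarrow> f (cell j) = g (cell j)"
      using g unfolding good_def by blast
    \<comment> \<open>Lists of the wrong length have codes as well; they lie in no box, and 0 stands
      for their value. Hence the bound \<open>c \<le> C\<close>: the strict one could fail for
      \<open>C = 0\<close>.\<close>
    define c where "c = (if cell m \<in> Zd d then f (cell m) else 0)"
    have "c \<le> C"
    proof (cases "cell m \<in> Zd d")
      case True
      then have "cell m \<in> box d N" using N0 box_mono[of N0 N d] by (auto simp: N_def)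
      then have "f (cell m) < C" using f(1) unfolding fills_def by blast
      then show ?thesis using True by (simp add: c_def)
    qed (simp add: c_def)
    then have "B c \<le> (\<Sum>c\<le>C. B c)" by (intro member_le_sum) auto
    then have "B c \<le> N" by (simp add: N_def)
    have "\<forall>j<Suc m. cell j \<in> box d (B c) \<longrightarrow> f (cell j) = (g(cell m := c)) (cell j)"
    proof (intro allI impI)
      fix j
      assume j: "j < Suc m" "cell j \<in> box d (B c)"
      then have "cell j \<in> box d N" "cell j \<in> Zd d"
        using box_mono[OF \<open>B c \<le> N\<close>, of d] by (auto simp: box_def)
      then show "f (cell j) = (g(cell m := c)) (cell j)"
        using f(2) j(1) by (auto simp: c_def less_Suc_eq)
    qed
    with B[OF fills_mono[OF f(1) \<open>B c \<le> N\<close>]] show False by blast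
  qed
  define G where "G = rec_nat (\<lambda>_. 0) (\<lambda>m g. g(cell m := SOME c. good (Suc m) (g(cell m := c))))"
  have G_Suc: "G (Suc m) = (G m)(cell m := SOME c. good (Suc m) ((G m)(cell m := c)))" for m
    by (simp add: G_def)
  have good_G: "good m (G m)" for m
  proof (induction m)
    case 0
    show ?case using fills by (simp add: good_def)
  next
    case (Suc m)
    from someI_ex[OF extend[OF this]] have "good (Suc m) (G (Suc m))" unfolding G_Suc .
    then show ?case .
  qed
  have stable: "G m (cell j) = G (Suc j) (cell j)" if "j < m" for j m
    using that
  proof (induction m)
    case (Suc m)
    have "cell j \<noteq> cell m" if "j < m" using that index_cell by (metis less_irrefl)
    with Suc show ?case by (cases "j = m") (auto simp: G_def)
  qed simp
  define x where "x = (\<lambda>v\<in>Zd d. G (Suc (index v)) v)"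
  have x_eq: "x v = G m v" if "index v < m" "v \<in> Zd d" for v m
    using stable[OF that(1)] that(2) by (simp add: x_def cell_index)
  \<comment> \<open>Finitely many cells are all fixed by some stage \<open>m\<close> and lie in a
    common box, so \<open>x\<close> inherits every local condition from a filling.\<close>
  have local: "\<exists>N f. fills d C L p N f \<and> V \<subseteq> box d N \<and> (\<forall>v\<in>V. f v = x v)"
    if V: "finite V" "V \<subseteq> Zd d" for V
  proof -
    obtain b where b: "\<And>v. v \<in> V \<Longrightarrow> v \<in> box d (b v)"
      using bchoice[of V "\<lambda>v N. v \<in> box d N"] in_some_box V(2) by blast
    define N where "N = (\<Sum>v\<in>V. b v)"
    have VN: "V \<subseteq> box d N"
    proof
      fix v assume "v \<in> V"
      then have "b v \<le> N" unfolding N_def using V(1) by (intro member_le_sum) auto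
      then show "v \<in> box d N" using b[OF \<open>v \<in> V\<close>] box_mono by blast
    qed
    define m where "m = Suc (\<Sum>v\<in>V. index v)"
    have m: "index v < m" if "v \<in> V" for v
      unfolding m_def using that V(1) by (intro le_imp_less_Suc member_le_sum) auto
    obtain f where f: "fills d C L p N f" "\<forall>j<m. cell j \<in> box d N \<longrightarrow> f (cell j) = G m (cell j)"
      using good_G[of m] unfolding good_def by blast
    have "f v = x v" if v: "v \<in> V" for v
    proof -
      have "cell (index v) \<in> box d N \<longrightarrow> f (cell (index v)) = G m (cell (index v))"
        using f(2) m[OF v] by blast
      then show ?thesis
        unfolding cell_index using x_eq[OF m[OF v]] subsetD[OF VN v] subsetD[OF V(2) v] by simp
    qed
    with f(1) VN show ?thesis by blast
  qed
  have cell_ok: "x v < C \<and> (\<forall>a. p v = Some a \<longrightarrow> x v = a) \<and> window x v \<notin> set L" if v: "v \<in> Zd d" for v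
  proof -
    obtain N f where f: "fills d C L p N f" "{v, west v, east v, north v} \<subseteq> box d N"
      "\<forall>u\<in>{v, west v, east v, north v}. f u = x u"
      using local[of "{v, west v, east v, north v}"] v by auto
    then have "window x v = window f v" by (simp add: window_def)
    with f show ?thesis unfolding fills_def by auto
  qed
  have "x \<in> window_shift d C L"
    unfolding window_shift_def using cell_ok by (auto simp: x_def PiE_iff)
  moreover have "\<forall>s\<in>dom p \<inter> Zd d. p s = Some (x s)" using cell_ok by auto
  ultimately show "\<exists>x\<in>window_shift d C L. \<forall>s\<in>dom p \<inter> Zd d. p s = Some (x s)" by blast
qed

section \<open>Exhaustive search of a box\<close>

primrec boxes :: "nat \<Rightarrow> nat \<Rightarrow> int list list" where
  "boxes 0 N = [[]]"
| "boxes (Suc d) N = concat (map (\<lambda>i. map (\<lambda>w. i # w) (boxes d N))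
     (map int [0..<Suc N] @ map (\<lambda>n. - int n) [0..<Suc N]))"

text \<open>The coordinate 0 is listed twice, as 0 and as -0, so cells recur in
  \<open>boxes\<close>. This does no harm: a filling is read by \<open>map_of\<close>, and its first
  entry for a cell counts.\<close>

lemma set_boxes: "set (boxes d N) = box d N"
proof (induction d)
  case 0
  show ?case by (auto simp: box_def Zd_def)
next
  case (Suc d)
  have "set (map int [0..<Suc N] @ map (\<lambda>n. - int n) [0..<Suc N]) = {i. \<bar>i\<bar> \<le> int N}"
  proof (intro set_eqI iffI)
    fix i assume "i \<in> {i. \<bar>i\<bar> \<le> int N}"
    then show "i \<in> set (map int [0..<Suc N] @ map (\<lambda>n. - int n) [0..<Suc N])"
      by (cases i rule: int_cases2) (auto simp del: upt_Suc)
  qed auto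
  moreover have "set (boxes (Suc d) N) =
      (\<lambda>(i, w). i # w) ` (set (map int [0..<Suc N] @ map (\<lambda>n. - int n) [0..<Suc N]) \<times> set (boxes d N))"
    by (auto simp del: upt_Suc)
  moreover have "(\<lambda>(i, w). i # w) ` ({i. \<bar>i\<bar> \<le> int N} \<times> box d N) = box (Suc d) N"
    by (auto simp: box_def Zd_def length_Suc_conv image_iff)
  ultimately show ?case using Suc by metis
qed

definition fillings :: "nat \<Rightarrow> int list list \<Rightarrow> (int list \<times> nat) list list" where
  "fillings C vs = foldr (\<lambda>v acc. concat (map (\<lambda>c. map (\<lambda>g. (v, c) # g) acc) [0..<C])) vs [[]]"

lemma set_fillings: "set (fillings C vs) = {g. map fst g = vs \<and> (\<forall>c\<in>set g. snd c < C)}"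
proof (induction vs)
  case Nil
  show ?case by (auto simp: fillings_def)
next
  case (Cons v vs)
  have "set (fillings C (v # vs)) = (\<lambda>(c, g). (v, c) # g) ` ({..<C} \<times> set (fillings C vs))"
    by (auto simp: fillings_def)
  also have "\<dots> = {g. map fst g = v # vs \<and> (\<forall>c\<in>set g. snd c < C)}"
    unfolding Cons by (auto simp: map_eq_Cons_conv image_iff)
  finally show ?case .
qed

text \<open>Cells outside the box get \<open>C\<close>, which is not a symbol. If the entries of
  \<open>L\<close> are below \<open>C\<close>, a window that leaves the box cannot be in
  \<open>L\<close>, and this replaces the test for neighbours in \<open>fills\<close>.\<close>

definition val :: "nat \<Rightarrow> (int list \<times> nat) list \<Rightarrow> int list \<Rightarrow> nat" where
  "val C g v = (case map_of g v of None \<Rightarrow> C | Some c \<Rightarrow> c)"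

definition admissible :: "nat \<Rightarrow> nat \<Rightarrow> (nat \<times> nat \<times> nat \<times> nat) list \<Rightarrow> (int list \<times> nat) list \<Rightarrow> nat \<Rightarrow> (int list \<times> nat) list \<Rightarrow> bool" where
  "admissible d C L P N g \<longleftrightarrow> (\<forall>v\<in>set (boxes d N).
     (case map_of P v of None \<Rightarrow> True | Some a \<Rightarrow> val C g v = a) \<and>
     \<not> (\<exists>q\<in>set L. q = window (val C g) v))"

definition refuted :: "nat \<Rightarrow> nat \<Rightarrow> (nat \<times> nat \<times> nat \<times> nat) list \<Rightarrow> (int list \<times> nat) list \<Rightarrow> nat \<Rightarrow> bool" where
  "refuted d C L P N \<longleftrightarrow> \<not> (\<exists>g\<in>set (fillings C (boxes d N)). admissible d C L P N g)"

lemma refuted_iff: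
  assumes L: "\<And>w c e n. (w, c, e, n) \<in> set L \<Longrightarrow> w < C \<and> c < C \<and> e < C \<and> n < C"
  shows "refuted d C L P N \<longleftrightarrow> \<not> (\<exists>f. fills d C L (map_of P) N f)"
proof -
  have "\<exists>f. fills d C L (map_of P) N f"
    if g: "g \<in> set (fillings C (boxes d N))" "admissible d C L P N g" for g
  proof -
    have "map fst g = boxes d N" "\<forall>c\<in>set g. snd c < C" using g(1) by (simp_all add: set_fillings)
    then have "val C g v < C" if "v \<in> box d N" for v
      using that map_of_SomeD[of g v] map_of_eq_None_iff[of g v] unfolding set_boxes[symmetric] val_def
      by (fastforce simp flip: list.set_map split: option.splits)
    then have "fills d C L (map_of P) N (val C g)"
      using g(2) unfolding admissible_def fills_def set_boxes by (auto split: option.splits)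
    then show ?thesis by blast
  qed
  moreover have "\<exists>g\<in>set (fillings C (boxes d N)). admissible d C L P N g"
    if f: "fills d C L (map_of P) N f" for f
  proof
    let ?g = "map (\<lambda>v. (v, f v)) (boxes d N)"
    have val: "val C ?g v = (if v \<in> box d N then f v else C)" for v
      by (simp add: val_def map_of_map_restrict set_boxes[symmetric] restrict_map_def)
    show "?g \<in> set (fillings C (boxes d N))"
      using f by (auto simp: set_fillings set_boxes fills_def comp_def)
    show "admissible d C L P N ?g"
      unfolding admissible_def set_boxes
    proof (intro ballI conjI)
      fix v assume v: "v \<in> box d N"
      show "case map_of P v of None \<Rightarrow> True | Some a \<Rightarrow> val C ?g v = a"
        using f v by (auto simp: fills_def val split: option.splits)
      show "\<not> (\<exists>q\<in>set L. q = window (val C ?g) v)"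
      proof (cases "west v \<in> box d N \<and> east v \<in> box d N \<and> north v \<in> box d N")
        case True
        then have "window (val C ?g) v = window f v" using v by (simp add: window_def val)
        then show ?thesis using True f v by (auto simp: fills_def)
      next
        case False
        then have "\<not> (val C ?g (west v) < C \<and> val C ?g (east v) < C \<and> val C ?g (north v) < C)"
          by (auto simp only: val less_irrefl if_False split: if_splits)
        then show ?thesis unfolding window_def by (blast dest: L)
      qed
    qed
  qed
  ultimately show ?thesis unfolding refuted_def by blast
qed

lemma prim_boxes: "prim f \<Longrightarrow> prim (\<lambda>x. boxes d (f x))"
proof (induction d)
  case (Suc d)
  note * = Suc.IH[OF Suc.prems]
  show ?case unfolding boxes.simps
    by (intro prim_rules Suc.prems prim_comp[OF *])
qed (simp add: prim_const)

lemma prim_refuted: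
  assumes "prim f" "prim g" shows "prim (\<lambda>x. refuted d C L (f x) (g x))"
  unfolding refuted_def admissible_def fillings_def val_def window_def west_def east_def north_def
  by (intro prim_rules prim_boxes assms prim_comp[OF assms(1)] prim_comp[OF assms(2)])

section \<open>Membership in the class Pi02\<close>

definition cells_decode :: "nat \<Rightarrow> (int list \<times> nat) list" where
  "cells_decode v = map cell_decode (list_decode v)"

lemma pattern_decode_cells: "pattern_decode v = map_of (cells_decode v)"
  by (simp add: pattern_decode_def cells_decode_def)

lemma cells_decode_enc: "cells_decode (enc P) = P"
proof -
  have "cell_decode (enc c) = c" for c :: "int list \<times> nat"
    by (cases c) (simp add: cell_decode_def enc_list_def comp_def)
  then show ?thesis by (simp add: cells_decode_def enc_list_def comp_def)
qed

lemma enc_cells_decode: "enc (cells_decode v) = v"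
proof -
  have "enc (cell_decode k) = k" for k
  proof -
    obtain s a where "prod_decode k = (s, a)" by fastforce
    then have "k = prod_encode (s, a)" "cell_decode k = (map int_decode (list_decode s), a)"
      by (metis prod_decode_inverse) (simp add: cell_decode_def \<open>prod_decode k = (s, a)\<close>)
    then show ?thesis by (simp add: enc_list_def comp_def)
  qed
  then show ?thesis by (simp add: cells_decode_def enc_list_def comp_def)
qed

lemma prim_cells_decode: assumes "prim f" shows "prim (\<lambda>x. cells_decode (f x))"
proof -
  have "prim cells_decode" by (rule primI[OF looping_id]) (simp add: enc_cells_decode)
  then show ?thesis using assms by (rule prim_comp)
qed

text \<open>A code may list a cell several times with different symbols, of which only the first
  belongs to the pattern; so the symbol is looked up instead of being taken from the entry.\<close>

definition pattern_ok :: "nat \<Rightarrow> nat \<Rightarrow> (int list \<times> nat) list \<Rightarrow> bool" where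
  "pattern_ok d a P \<longleftrightarrow> (\<forall>c\<in>set P. length (fst c) = d \<and>
     (case map_of P (fst c) of None \<Rightarrow> True | Some y \<Rightarrow> y \<in> set_decode a))"

lemma pattern_ok_iff: "pattern_ok d a P \<longleftrightarrow> is_pattern d (set_decode a) (map_of P)"
proof -
  have "(\<forall>c\<in>set P. case map_of P (fst c) of None \<Rightarrow> True | Some y \<Rightarrow> y \<in> set_decode a)
      \<longleftrightarrow> (\<forall>s\<in>dom (map_of P). the (map_of P s) \<in> set_decode a)"
    unfolding dom_map_of_conv_image_fst
    by (auto split: option.splits) (metis domD domIff dom_map_of_conv_image_fst fst_conv imageI option.sel)
  also have "\<dots> \<longleftrightarrow> ran (map_of P) \<subseteq> set_decode a"
    by (auto simp: ran_def dom_def subset_iff)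
  finally show ?thesis
    unfolding pattern_ok_def is_pattern_def
    by (auto simp: finite_dom_map_of dom_map_of_conv_image_fst Zd_def)
qed

text \<open>Compactness turns non-appearance into an existential statement over a decidable one;
  this supplies the inner quantifier of the class.\<close>

lemma never_appears_iff_refuted:
  assumes L: "\<And>w c e n. (w, c, e, n) \<in> set L \<Longrightarrow> w < C \<and> c < C \<and> e < C \<and> n < C"
    and P: "dom (map_of P) \<subseteq> Zd d"
  shows "(\<forall>x\<in>window_shift d C L. \<not> appears_in d (map_of P) x) \<longleftrightarrow> (\<exists>N. refuted d C L P N)"
proof -
  have "map_of P = (\<lambda>s. if s \<in> Zd d then map_of P s else None)"
    using P by (auto simp: fun_eq_iff)
  from appears_in_window_shift[OF this, of C L] window_shift_compact[of d C L "map_of P"] P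
  have "(\<exists>x\<in>window_shift d C L. appears_in d (map_of P) x) \<longleftrightarrow> (\<forall>N. \<exists>f. fills d C L (map_of P) N f)"
    by (simp add: inf_absorb1)
  moreover have "refuted d C L P N \<longleftrightarrow> \<not> (\<exists>f. fills d C L (map_of P) N f)" for N
    using L by (rule refuted_iff)
  ultimately show ?thesis by auto
qed

theorem Pi02_inclusion_problem:
  assumes L: "\<And>w c e n. (w, c, e, n) \<in> set L \<Longrightarrow> w < C \<and> c < C \<and> e < C \<and> n < C"
  shows "Pi02 (inclusion_problem d (window_shift d C L))"
proof -
  let ?Y = "window_shift d C L"
  \<comment> \<open>Exactly the symbols that occur in \<open>?Y\<close> must belong to the alphabet
    of X. The list \<open>ss\<close> of them is a constant of the decision procedure, so its mere
    existence is enough.\<close>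
  define S where "S = {x v |x v. x \<in> ?Y \<and> v \<in> Zd d}"
  have "S \<subseteq> {..<C}" by (auto simp: S_def window_shift_def dest: PiE_mem)
  then have "finite S" by (rule finite_subset) simp
  then obtain ss where ss: "set ss = S" using finite_list by blast
  define a e where "a = (\<lambda>i. fst (prod_decode i))" and "e = (\<lambda>i. snd (prod_decode i))"
  have incl: "i \<in> inclusion_problem d ?Y \<longleftrightarrow> (\<forall>c\<in>set ss. c \<in> set_decode (a i)) \<and>
      (\<forall>n v. tm_computes (tm_decode (e i)) n v \<longrightarrow> pattern_ok d (a i) (cells_decode v) \<longrightarrow>
         (\<exists>N. refuted d C L (cells_decode v) N))" for i
  proof -
    have "?Y \<subseteq> Zd d \<rightarrow>\<^sub>E set_decode (a i) \<longleftrightarrow> S \<subseteq> set_decode (a i)"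
      unfolding S_def by (auto simp: window_shift_def PiE_iff subset_iff)
    moreover have "pattern_ok d (a i) (cells_decode v) \<Longrightarrow>
        (\<forall>x\<in>?Y. \<not> appears_in d (pattern_decode v) x) \<longleftrightarrow> (\<exists>N. refuted d C L (cells_decode v) N)" for v
      unfolding pattern_decode_cells
      by (rule never_appears_iff_refuted[OF L]) (auto simp: pattern_ok_iff is_pattern_def)
    moreover have "effective_subshift d i = {x \<in> Zd d \<rightarrow>\<^sub>E set_decode (a i). \<forall>n v.
        tm_computes (tm_decode (e i)) n v \<longrightarrow> pattern_ok d (a i) (cells_decode v) \<longrightarrow>
        \<not> appears_in d (pattern_decode v) x}"
      unfolding effective_subshift_def subshift_def enumerated_patterns_def a_def e_def
        pattern_ok_iff pattern_decode_cells Let_def case_prod_unfold by blast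
    ultimately show ?thesis unfolding inclusion_problem_def ss by blast
  qed
  \<comment> \<open>The universal \<open>y\<close> codes an input and a time bound for the
    enumerating machine; the existential \<open>z\<close> is the size of a box.\<close>
  define T where "T = (\<lambda>i y z. (\<forall>c\<in>set ss. c \<in> set_decode (a i)) \<and>
      (case outcome (tm_decode (e i)) (fst (prod_decode y)) (snd (prod_decode y)) of
         None \<Rightarrow> True
       | Some v \<Rightarrow> pattern_ok d (a i) (cells_decode v) \<longrightarrow> refuted d C L (cells_decode v) z))"
  define R where "R = {q. T (fst (prod_decode q)) (fst (prod_decode (snd (prod_decode q))))
      (snd (prod_decode (snd (prod_decode q))))}"
  have "prim (\<lambda>q. q \<in> R)"
    unfolding R_def mem_Collect_eq T_def a_def e_def pattern_ok_def
    by (intro prim_rules prim_prod_decode prim_outcome prim_tm_decode prim_refuted prim_cells_decode)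
  then have "decidable R" by (rule prim_decidable)
  moreover have "i \<in> inclusion_problem d ?Y \<longleftrightarrow> (\<forall>y. \<exists>z. prod_encode (i, prod_encode (y, z)) \<in> R)" for i
  proof -
    have 1: "(\<forall>y. \<exists>z. T i y z) \<longleftrightarrow> (\<forall>n s. \<exists>z. T i (prod_encode (n, s)) z)"
      by (metis prod_decode_inverse surj_pair)
    have 2: "(\<exists>z. T i (prod_encode (n, s)) z) \<longleftrightarrow> (\<forall>c\<in>set ss. c \<in> set_decode (a i)) \<and>
        (\<forall>v. outcome (tm_decode (e i)) n s = Some v \<longrightarrow> pattern_ok d (a i) (cells_decode v) \<longrightarrow>
          (\<exists>N. refuted d C L (cells_decode v) N))" for n s
      by (cases "outcome (tm_decode (e i)) n s") (auto simp: T_def)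
    have "(\<forall>y. \<exists>z. T i y z) \<longleftrightarrow> i \<in> inclusion_problem d ?Y"
      unfolding 1 2 incl tm_computes_iff_outcome by (intro iffI conjI allI impI) blast+
    then show ?thesis by (simp add: R_def)
  qed
  ultimately show ?thesis unfolding Pi02_def by blast
qed

section \<open>Space-time diagrams\<close>

text \<open>
  Symbols of the subshift: 0 is a wildcard for the rows before the start of the computation, 1 and
  2 are the blanks to the left and to the right of the input in the initial row, and \<open>cell a k\<close> is
  a tape cell with symbol \<open>a\<close>, without head if \<open>k = 0\<close> and with the head in state \<open>q\<close> if
  \<open>k = Suc q\<close>. Time runs north. A head that halts has no \<open>next_cell\<close>, so every window around it
  is bad. In the sum in \<open>next_cell\<close> at most one term is nonzero if there is only one head.
\<close>

definition cell :: "nat \<Rightarrow> nat \<Rightarrow> nat" where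
  "cell a k = 3 + prod_encode (a, k)"

definition view :: "nat \<Rightarrow> nat \<times> nat" where
  "view c = (if c < 3 then (0, 0) else prod_decode (c - 3))"

lemma view_cell [simp]: "view (cell a k) = (a, k)"
  by (simp add: view_def cell_def)

lemma view_blank [simp]: "view (Suc 0) = (0, 0)" "view 2 = (0, 0)"
  by (simp_all add: view_def)

lemma cell_ge: "3 \<le> cell a k"
  by (simp add: cell_def)

definition arriving :: "tm \<Rightarrow> move \<Rightarrow> nat \<times> nat \<Rightarrow> nat" where
  "arriving M m s = (case snd s of 0 \<Rightarrow> 0 | Suc q \<Rightarrow>
     (case map_of M (q, fst s) of None \<Rightarrow> 0 | Some (q', b, m') \<Rightarrow> if m' = m then Suc q' else 0))"

definition next_cell :: "tm \<Rightarrow> nat \<times> nat \<Rightarrow> nat \<times> nat \<Rightarrow> nat \<times> nat \<Rightarrow> nat option" where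
  "next_cell M w c e = (case snd c of
     0 \<Rightarrow> Some (cell (fst c) (arriving M Move_Right w + arriving M Move_Left e))
   | Suc q \<Rightarrow> (case map_of M (q, fst c) of
       None \<Rightarrow> None | Some (q', b, m) \<Rightarrow> Some (cell b (if m = Stay then Suc q' else 0))))"

text \<open>The first two disjuncts spread the blanks 1 to the west and 2 to the east. A wildcard
  among \<open>w\<close>, \<open>c\<close>, \<open>e\<close> switches the transition rule off, so a
  row of wildcards puts no condition on the row north of it.\<close>

fun bad :: "tm \<Rightarrow> nat \<times> nat \<times> nat \<times> nat \<Rightarrow> bool" where
  "bad M (w, c, e, n) \<longleftrightarrow> c = 1 \<and> w \<noteq> 1 \<or> c = 2 \<and> e \<noteq> 2 \<or>
     w \<noteq> 0 \<and> c \<noteq> 0 \<and> e \<noteq> 0 \<and> next_cell M (view w) (view c) (view e) \<noteq> Some n"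

definition bad_list :: "tm \<Rightarrow> nat \<Rightarrow> (nat \<times> nat \<times> nat \<times> nat) list" where
  "bad_list M C = filter (bad M)
     (List.product [0..<C] (List.product [0..<C] (List.product [0..<C] [0..<C])))"

lemma set_bad_list:
  "(w, c, e, n) \<in> set (bad_list M C) \<longleftrightarrow> w < C \<and> c < C \<and> e < C \<and> n < C \<and> bad M (w, c, e, n)"
  by (auto simp: bad_list_def)

section \<open>Rows of a diagram and the seed of a computation\<close>

fun config_cell :: "tm_config \<Rightarrow> int \<Rightarrow> nat" where
  "config_cell (q, h, t) i = cell (t i) (if i = h then Suc q else 0)"

lemma config_cell_ge: "3 \<le> config_cell c i"
  using cell_ge by (cases c) simp

lemma next_cell_moves:
  assumes "moves M c c'"
  shows "next_cell M (view (config_cell c (i - 1))) (view (config_cell c i)) (view (config_cell c (i + 1)))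
    = Some (config_cell c' i)"
proof -
  obtain q h t where c: "c = (q, h, t)" by (cases c)
  obtain q' b m where m: "map_of M (q, t h) = Some (q', b, m)" "c' = (q', h + displacement m, t(h := b))"
    using assms c moves_iff by blast
  consider "i = h" | "i = h + 1" | "i = h - 1" | "i \<noteq> h" "i \<noteq> h + 1" "i \<noteq> h - 1" by blast
  then show ?thesis
    by cases (cases m; auto simp: c m next_cell_def arriving_def)+
qed

lemma next_cell_halted:
  assumes "map_of M (q, t h) = None"
  shows "next_cell M w (view (config_cell (q, h, t) h)) e = None"
  using assms by (simp add: next_cell_def)

text \<open>Column 0 is an ordinary cell even for empty input, as the head has to be shown
  there.\<close>

definition initial_row :: "nat \<Rightarrow> int \<Rightarrow> nat" where
  "initial_row m i = (if i < 0 then 1 else if i = 0 \<or> i < int m then config_cell (tm_initial m) i else 2)"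

lemma view_initial_row: "view (initial_row m i) = view (config_cell (tm_initial m) i)"
  by (auto simp: initial_row_def tm_initial_def)

lemma initial_row_nonzero: "initial_row m i \<noteq> 0"
  using config_cell_ge[of "tm_initial m" i] by (auto simp: initial_row_def)

text \<open>With the columns from -1 to \<open>m + 1\<close> a seed begins with a 1 and ends with a
  2 even for \<open>m = 0\<close>; these two symbols force the rest of the row.\<close>

definition seed :: "nat \<Rightarrow> nat \<Rightarrow> (int list \<times> nat) list" where
  "seed k m = map (\<lambda>i. (i # replicate (Suc k) 0, initial_row m i)) ((0 - 1) # map int [0..<Suc (Suc m)])"

lemma map_of_seed:
  "map_of (seed k m) s = Some a \<longleftrightarrow>
     (\<exists>i. s = i # replicate (Suc k) 0 \<and> -1 \<le> i \<and> i \<le> int m + 1 \<and> a = initial_row m i)"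
proof
  assume "map_of (seed k m) s = Some a"
  then have "(s, a) \<in> set (seed k m)" by (rule map_of_SomeD)
  then show "\<exists>i. s = i # replicate (Suc k) 0 \<and> -1 \<le> i \<and> i \<le> int m + 1 \<and> a = initial_row m i"
    unfolding seed_def by (auto simp del: upt_Suc replicate_Suc)
next
  assume "\<exists>i. s = i # replicate (Suc k) 0 \<and> -1 \<le> i \<and> i \<le> int m + 1 \<and> a = initial_row m i"
  then obtain i where i: "s = i # replicate (Suc k) 0" "-1 \<le> i" "i \<le> int m + 1" "a = initial_row m i"
    by blast
  have "i = -1 \<or> (\<exists>n. i = int n \<and> n < Suc (Suc m))"
    using i(2,3) by (cases i rule: int_cases2) auto
  then have "i \<in> set ((0 - 1) # map int [0..<Suc (Suc m)])" by (auto simp del: upt_Suc)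
  then have "(s, a) \<in> set (seed k m)" unfolding seed_def i(1,4) set_map by (rule imageI)
  then obtain b where b: "map_of (seed k m) s = Some b" using weak_map_of_SomeI by metis
  then have "(s, b) \<in> set (seed k m)" by (rule map_of_SomeD)
  then have "b = a" using i(1,4) unfolding seed_def by (auto simp del: upt_Suc replicate_Suc)
  with b show "map_of (seed k m) s = Some a" by simp
qed

text \<open>If the run halted, the row of the halting configuration would be forced, and no symbol
  is admissible north of its head.\<close>

lemma seed_appears_imp_diverges:
  assumes x: "x \<in> window_shift (Suc (Suc k)) C (bad_list M C)"
    and seed: "\<forall>s\<in>dom (map_of (seed k m)). map_of (seed k m) s = Some (x s)"
  shows "\<not> halts M m"
proof
  assume "halts M m"
  then obtain q h t where c: "reaches M (tm_initial m) (q, h, t)" "map_of M (q, t h) = None"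
    unfolding halts_iff by blast
  define r where "r = (\<lambda>j i. x (i # j # replicate k 0))"
  have "x v < C" if "v \<in> Zd (Suc (Suc k))" for v
    using x that unfolding window_shift_def by (auto dest: PiE_mem)
  then have rC: "r j i < C" for i j by (simp add: r_def Zd_def)
  have ok: "\<not> bad M (r j (i - 1), r j i, r j (i + 1), r (j + 1) i)" for i j
  proof -
    have "window x (i # j # replicate k 0) \<notin> set (bad_list M C)"
      using x unfolding window_shift_def by (simp add: Zd_def)
    moreover have "window x (i # j # replicate k 0) = (r j (i - 1), r j i, r j (i + 1), r (j + 1) i)"
      by (simp add: window_def r_def west_def east_def north_def)
    ultimately show ?thesis using rC by (simp add: set_bad_list)
  qed
  have mid: "r 0 i = initial_row m i" if "-1 \<le> i" "i \<le> int m + 1" for i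
  proof -
    have "map_of (seed k m) (i # replicate (Suc k) 0) = Some (initial_row m i)"
      using that by (simp add: map_of_seed)
    moreover from this have "i # replicate (Suc k) 0 \<in> dom (map_of (seed k m))" by blast
    ultimately show ?thesis using seed unfolding r_def by simp
  qed
  have left: "r 0 (-1 - int n) = 1" for n
  proof (induction n)
    case 0
    show ?case using mid[of "-1"] by (simp add: initial_row_def)
  next
    case (Suc n)
    then show ?case using ok[of 0 "-1 - int n"] by (simp add: algebra_simps)
  qed
  have right: "r 0 (int m + 1 + int n) = 2" for n
  proof (induction n)
    case 0
    show ?case using mid[of "int m + 1"] by (simp add: initial_row_def)
  next
    case (Suc n)
    then show ?case using ok[of 0 "int m + 1 + int n"] by (simp add: algebra_simps)
  qed
  have row0: "r 0 i = initial_row m i" for i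
  proof -
    consider "i < -1" | "-1 \<le> i" "i \<le> int m + 1" | "int m + 1 < i" by linarith
    then show ?thesis
    proof cases
      case 1
      then show ?thesis using left[of "nat (-1 - i)"] by (simp add: initial_row_def)
    next
      case 3
      then show ?thesis using right[of "nat (i - int m - 1)"] by (simp add: initial_row_def)
    qed (rule mid)
  qed
  \<comment> \<open>Only views are compared, because row 0 has the blanks 1 and 2 where later rows
    have \<open>cell 0 0\<close>. That no symbol is the wildcard keeps the transition rule in
    force.\<close>
  have "\<exists>n. \<forall>i. r (int n) i \<noteq> 0 \<and> view (r (int n) i) = view (config_cell (q, h, t) i)"
    using c(1)
  proof (induction rule: rtranclp_induct)
    case base
    show ?case using row0 view_initial_row initial_row_nonzero by (intro exI[of _ 0]) simp
  next
    case (step c c')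
    then obtain n where n: "\<And>i. r (int n) i \<noteq> 0" "\<And>i. view (r (int n) i) = view (config_cell c i)"
      by blast
    have "r (int (Suc n)) i = config_cell c' i" for i
      using ok[of "int n" i] n next_cell_moves[OF step(2), of i] by (simp add: add.commute)
    then show ?case
      using config_cell_ge[of c'] by (intro exI[of _ "Suc n"]) (metis not_numeral_le_zero)
  qed
  then obtain n where n: "\<And>i. r (int n) i \<noteq> 0" "\<And>i. view (r (int n) i) = view (config_cell (q, h, t) i)"
    by blast
  have "next_cell M (view (r (int n) (h - 1))) (view (r (int n) h)) (view (r (int n) (h + 1))) = None"
    unfolding n(2)[of h] by (rule next_cell_halted[where t = t, OF c(2)])
  then show False using ok[of "int n" h] n(1) by simp
qed

text \<open>An endless run supplies a row for every time; wildcards fill the rows before it, and the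
  same slice is repeated along the other coordinates.\<close>

lemma diverges_imp_seed_appears:
  assumes "\<not> halts M m"
    and C: "2 < C" "\<And>c i. reaches M (tm_initial m) c \<Longrightarrow> config_cell c i < C"
  shows "\<exists>x\<in>window_shift (Suc (Suc k)) C (bad_list M C).
    \<forall>s\<in>dom (map_of (seed k m)). map_of (seed k m) s = Some (x s)"
proof -
  define run where "run = rec_nat (tm_initial m) (\<lambda>_ c. the (tm_step M c))"
  have run: "reaches M (tm_initial m) (run n) \<and> moves M (run n) (run (Suc n))" for n
  proof (induction n)
    case 0
    have "tm_step M (tm_initial m) \<noteq> None"
      using assms(1) rtranclp.rtrancl_refl[of "moves M" "tm_initial m"] unfolding halts_def by metis
    then show ?case by (auto simp: run_def moves_def)
  next
    case (Suc n)
    then have r: "reaches M (tm_initial m) (run (Suc n))" by (auto intro: reaches_move)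
    have "tm_step M (run (Suc n)) \<noteq> None"
    proof
      assume "tm_step M (run (Suc n)) = None"
      with r have "halts M m" unfolding halts_def by (intro exI conjI)
      with assms(1) show False by simp
    qed
    then have "moves M (run (Suc n)) (run (Suc (Suc n)))" by (auto simp: moves_def run_def)
    with r show ?case ..
  qed
  define r where "r = (\<lambda>j i. if j < 0 then 0 else if j = 0 then initial_row m i
      else config_cell (run (nat j)) i)"
  have r_view: "view (r j i) = view (config_cell (run (nat j)) i)" if "0 \<le> j" for i j
    using that by (simp add: r_def view_initial_row run_def)
  have r_pos: "3 \<le> r j i" if "0 < j" for i j
    using that config_cell_ge by (simp add: r_def)
  have ok: "\<not> bad M (r j (i - 1), r j i, r j (i + 1), r (j + 1) i)" for i j
  proof (cases "j < 0")
    \<comment> \<open>Three wildcards make the window admissible, also just below the initial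
      row.\<close>
    case True
    then show ?thesis by (simp add: r_def)
  next
    case False
    then have "r (j + 1) i = config_cell (run (Suc (nat j))) i"
      by (simp add: r_def nat_add_distrib)
    then have "next_cell M (view (r j (i - 1))) (view (r j i)) (view (r j (i + 1))) = Some (r (j + 1) i)"
      using False next_cell_moves run by (simp add: r_view)
    moreover have "r j i = 1 \<longrightarrow> r j (i - 1) = 1" "r j i = 2 \<longrightarrow> r j (i + 1) = 2"
      using False r_pos[of j i] config_cell_ge[of "tm_initial m" i]
      by (auto simp: r_def initial_row_def split: if_splits)
    ultimately show ?thesis by simp
  qed
  have rC: "r j i < C" for i j
    using C run by (simp add: r_def initial_row_def)
  define x where "x = (\<lambda>v\<in>Zd (Suc (Suc k)). r (hd (tl v)) (hd v))"
  have "window x v \<notin> set (bad_list M C)" if v: "v \<in> Zd (Suc (Suc k))" for v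
  proof -
    obtain a b w where "v = a # b # w" using v by (rule Zd_Suc2E)
    then have "window x v = (r b (a - 1), r b a, r b (a + 1), r (b + 1) a)"
      using v by (simp add: window_def x_def west_def east_def north_def Zd_def)
    then show ?thesis using ok[of b a] by (simp add: set_bad_list)
  qed
  then have "x \<in> window_shift (Suc (Suc k)) C (bad_list M C)"
    unfolding window_shift_def using rC by (auto simp: x_def PiE_iff)
  moreover have "x (i # replicate (Suc k) 0) = initial_row m i" for i
    by (simp add: x_def Zd_def r_def)
  then have "map_of (seed k m) s = Some (x s)" if s: "s \<in> dom (map_of (seed k m))" for s
    using s by (auto simp: map_of_seed)
  ultimately show ?thesis by blast
qed

text \<open>States and symbols of reachable configurations come from the table or from the start, so
  one finite alphabet serves all inputs.\<close>

lemma config_cells_bounded: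
  "\<exists>C>2. \<forall>m c i. reaches M (tm_initial m) c \<longrightarrow> config_cell c i < C"
proof -
  define Q where "Q = insert 0 ((\<lambda>r. fst (snd r)) ` set M)"
  define S where "S = {0, 1} \<union> (\<lambda>r. fst (snd (snd r))) ` set M"
  have inv: "fst c \<in> Q \<and> (\<forall>i. snd (snd c) i \<in> S)" if "reaches M (tm_initial m) c" for m c
    using that
  proof (induction rule: rtranclp_induct)
    case base
    show ?case by (simp add: tm_initial_def Q_def S_def)
  next
    case (step c c')
    obtain q h t where c: "c = (q, h, t)" by (cases c)
    obtain q' b m where m: "map_of M (q, t h) = Some (q', b, m)" "c' = (q', h + displacement m, t(h := b))"
      using step(2) c moves_iff by blast
    from map_of_SomeD[OF m(1)] have "q' \<in> Q" "b \<in> S"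
      unfolding Q_def S_def by force+
    then show ?case using step.IH m(2) c by simp
  qed
  let ?A = "(\<lambda>(a, k). cell a k) ` (S \<times> insert 0 (Suc ` Q))"
  have "finite ?A" by (simp add: Q_def S_def)
  then obtain B where B: "\<forall>c\<in>?A. c < B" using finite_nat_set_iff_bounded by blast
  have "config_cell c i < B + 3" if "reaches M (tm_initial m) c" for m c i
  proof -
    obtain q h t where c: "c = (q, h, t)" by (cases c)
    have "config_cell c i \<in> ?A" using inv[OF that] c by (auto simp: image_iff)
    then show ?thesis using B by fastforce
  qed
  then show ?thesis by (intro exI[of _ "B + 3"]) auto
qed

section \<open>Completeness\<close>

lemma prim_initial_row: assumes "prim f" "prim g" shows "prim (\<lambda>x. initial_row (f x) (int (g x)))"
proof -
  have "initial_row m (int n) = (if n = 0 then if m = 0 then cell 0 1 else cell 1 1 else if n < m then cell 1 0 else 2)"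
    for m n by (auto simp: initial_row_def tm_initial_def)
  then show ?thesis by (simp only:) (intro prim_rules assms)
qed

lemma prim_enc_seed: assumes "prim f" shows "prim (\<lambda>x. enc (seed k (f x)))"
proof -
  have "seed k m = (-1 # replicate (Suc k) 0, 1) #
      map (\<lambda>n. (int n # replicate (Suc k) 0, initial_row m (int n))) [0..<Suc (Suc m)]" for m
    by (simp add: seed_def initial_row_def comp_def del: upt_Suc)
  then show ?thesis
    by (simp only:) (intro prim_rules prim_initial_row prim_comp[OF assms] assms)
qed

text \<open>The s-m-n property: the code of a machine is obtained effectively from the constant
  built into it.\<close>

lemma prim_machine: "prim (\<lambda>x. enc (machine K c x))"
proof -
  have "prelude N M x = rec_nat M (\<lambda>j r. ((N + Suc j, 0), (N + j, 2, Move_Right)) #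
      ((N + Suc j, 1), (N + j, 3, Move_Right)) # r) x" for N M x
    by (induction x) auto
  then show ?thesis unfolding machine_def
    by (simp only:) (intro prim_rules)
qed

text \<open>\<open>w\<close> codes the pair of a number \<open>z\<close> and a running time of machine \<open>e\<close> on \<open>(x, y, z)\<close>.\<close>

definition accepts :: "nat \<Rightarrow> nat \<Rightarrow> nat \<Rightarrow> nat \<Rightarrow> bool" where
  "accepts e x y w \<longleftrightarrow> outcome (tm_decode e)
     (prod_encode (x, prod_encode (y, fst (prod_decode w)))) (snd (prod_decode w)) = Some 1"

definition search_code :: "nat \<Rightarrow> nat \<Rightarrow> nat \<Rightarrow> nat \<Rightarrow> nat" where
  "search_code e x y w = prod_encode (e, prod_encode (x, prod_encode (y, w)))"

lemma prim_prod_encode: "prim f \<Longrightarrow> prim g \<Longrightarrow> prim (\<lambda>x. prod_encode (f x, g x))"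
  using prim_enc[OF prim_Pair[of f g]] by simp

lemma prim_search_code:
  "prim e \<Longrightarrow> prim f \<Longrightarrow> prim g \<Longrightarrow> prim h \<Longrightarrow> prim (\<lambda>x. search_code (e x) (f x) (g x) (h x))"
  unfolding search_code_def by (intro prim_prod_encode)

text \<open>The search runs over pairs of a candidate and a time bound, so every single test
  terminates even if machine \<open>e\<close> diverges on some candidates.\<close>

lemma universal_search:
  "\<exists>U. \<forall>e x y. halts U (Suc (search_code e x y 0)) \<longleftrightarrow> (\<exists>w. accepts e x y w)"
proof -
  let ?p = "\<lambda>v. prod_decode v" and ?q = "\<lambda>v. prod_decode (snd (prod_decode v))"
    and ?r = "\<lambda>v. prod_decode (snd (prod_decode (snd (prod_decode v))))"
  \<comment> \<open>The value 0 reports success and \<open>Suc\<close> of a code asks for another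
    round; therefore the search starts at \<open>Suc\<close> of the first code.\<close>
  define g where "g = (\<lambda>v. if accepts (fst (?p v)) (fst (?q v)) (fst (?r v)) (snd (?r v)) then 0
      else Suc (search_code (fst (?p v)) (fst (?q v)) (fst (?r v)) (Suc (snd (?r v)))))"
  have g: "g (search_code e x y w) = (if accepts e x y w then 0 else Suc (search_code e x y (Suc w)))"
    for e x y w by (simp add: g_def search_code_def)
  have "prim g"
    unfolding g_def accepts_def
    by (intro prim_rules prim_outcome prim_tm_decode prim_prod_decode prim_prod_encode prim_search_code)
  then have "looping g" by (rule prim_looping)
  then show ?thesis
  proof (rule search_machine)
    fix U
    assume U: "\<And>m. halts U m \<longleftrightarrow> (\<exists>k. (case_nat 0 g ^^ k) m = 0)"
    have run: "(case_nat 0 g ^^ k) (Suc (search_code e x y 0)) = Suc (search_code e x y k)"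
      if "\<forall>w<k. \<not> accepts e x y w" for e x y k
      using that by (induction k) (simp_all add: g)
    have "halts U (Suc (search_code e x y 0)) \<longleftrightarrow> (\<exists>w. accepts e x y w)" for e x y
    proof
      assume "halts U (Suc (search_code e x y 0))"
      then show "\<exists>w. accepts e x y w" unfolding U using run[of _ e x y] by (metis nat.distinct(1))
    next
      assume "\<exists>w. accepts e x y w"
      then obtain w where w: "accepts e x y w" "\<forall>w'<w. \<not> accepts e x y w'"
        by (metis exists_least_iff)
      then have "(case_nat 0 g ^^ Suc w) (Suc (search_code e x y 0)) = 0"
        by (simp add: run g)
      then show "halts U (Suc (search_code e x y 0))" unfolding U by blast
    qed
    then show ?thesis by blast
  qed
qed

lemma Ex_accepts: "(\<exists>w. accepts e x y w) \<longleftrightarrow>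
    (\<exists>z. tm_computes (tm_decode e) (prod_encode (x, prod_encode (y, z))) 1)"
  unfolding tm_computes_iff_outcome accepts_def by (metis prod_encode_inverse fst_conv snd_conv)

text \<open>The reduction sends \<open>x\<close> to a shift over the alphabet of Y, so that
  inclusion depends on the patterns alone, with a machine that on input \<open>y\<close> outputs the
  seed for \<open>x\<close> and \<open>y\<close>.\<close>

theorem Pi02_reducible_to_inclusion_problem:
  assumes U: "\<And>e x y. halts U (Suc (search_code e x y 0)) \<longleftrightarrow> (\<exists>w. accepts e x y w)"
    and C: "2 < C" "\<And>m c i. reaches U (tm_initial m) c \<Longrightarrow> config_cell c i < C"
    and A: "Pi02 A"
  shows "A \<le>\<^sub>m inclusion_problem (Suc (Suc k)) (window_shift (Suc (Suc k)) C (bad_list U C))"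
proof -
  let ?d = "Suc (Suc k)"
  let ?Y = "window_shift ?d C (bad_list U C)"
  obtain R where R: "decidable R" "A = {x. \<forall>y. \<exists>z. prod_encode (x, prod_encode (y, z)) \<in> R}"
    using A unfolding Pi02_def by blast
  obtain M where M: "\<And>n. tm_computes M n (if n \<in> R then 1 else 0)"
    using R(1) unfolding decidable_def computable_def by blast
  have M1: "tm_computes M n 1 \<longleftrightarrow> n \<in> R" for n
    using M[of n] tm_computes_deterministic[of M n] by (metis zero_neq_one)
  define start where "start = (\<lambda>x y. Suc (search_code (enc M) x y 0))"
  have halts_start: "halts U (start x y) \<longleftrightarrow> (\<exists>z. prod_encode (x, prod_encode (y, z)) \<in> R)" for x y
    unfolding start_def U Ex_accepts tm_decode_enc M1 ..
  \<comment> \<open>The first component is the input of the enumerating machine and the second one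
    its built-in constant, in the order of \<open>looping_machine\<close>.\<close>
  let ?h = "\<lambda>n. enc (seed k (start (snd (prod_decode n)) (fst (prod_decode n))))"
  have "prim ?h"
    unfolding start_def by (intro prim_rules prim_enc_seed prim_search_code prim_prod_decode)
  then have "looping ?h" by (rule prim_looping)
  then show ?thesis
  proof (rule looping_machine)
    fix K c
    assume "\<And>x y. tm_computes (machine K c x) y (?h (prod_encode (y, x)))"
    then have mach: "tm_computes (machine K c x) y (enc (seed k (start x y)))" for x y by simp
    define f where "f = (\<lambda>x. prod_encode (set_encode {..<C}, enc (machine K c x)))"
    have "prim f" unfolding f_def by (intro prim_prod_encode prim_const prim_machine)
    then have "computable f" by (intro looping_computable prim_looping)
    moreover have "x \<in> A \<longleftrightarrow> f x \<in> inclusion_problem ?d ?Y" for x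
    proof -
      have row: "initial_row m i < C" for m i
        using C(1) C(2)[OF rtranclp.rtrancl_refl, of m i] by (simp add: initial_row_def)
      have pat: "is_pattern ?d {..<C} (map_of (seed k m))" for m
        by (auto simp: is_pattern_def finite_dom_map_of ran_def map_of_seed Zd_def row)
      \<comment> \<open>By determinism each input contributes this seed and no other pattern, so
        nothing else is forbidden.\<close>
      have comp: "tm_computes (machine K c x) n v \<longleftrightarrow> v = enc (seed k (start x n))" for n v
        using mach tm_computes_deterministic by blast
      have "enumerated_patterns ?d {..<C} (machine K c x) = range (\<lambda>y. map_of (seed k (start x y)))"
        unfolding enumerated_patterns_def comp pattern_decode_cells
        using pat by (auto simp: cells_decode_enc simp del: enc_Cons)
      then have eff: "effective_subshift ?d (f x) =
          subshift ?d {..<C} (range (\<lambda>y. map_of (seed k (start x y))))"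
        by (simp add: effective_subshift_def f_def tm_decode_enc)
      have seed: "(\<exists>X\<in>?Y. appears_in ?d (map_of (seed k m)) X) \<longleftrightarrow> \<not> halts U m" for m
      proof -
        have "map_of (seed k m) = (\<lambda>s. if s \<in> Zd ?d then map_of (seed k m) s else None)"
        proof
          fix s
          show "map_of (seed k m) s = (if s \<in> Zd ?d then map_of (seed k m) s else None)"
            by (cases "map_of (seed k m) s") (auto simp: map_of_seed Zd_def)
        qed
        then have "(\<exists>X\<in>?Y. appears_in ?d (map_of (seed k m)) X)
            \<longleftrightarrow> (\<exists>X\<in>?Y. \<forall>s\<in>dom (map_of (seed k m)). map_of (seed k m) s = Some (X s))"
          by (rule appears_in_window_shift)
        also have "\<dots> \<longleftrightarrow> \<not> halts U m"
        proof
          assume "\<not> halts U m"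
          then show "\<exists>X\<in>?Y. \<forall>s\<in>dom (map_of (seed k m)). map_of (seed k m) s = Some (X s)"
            using C by (rule diverges_imp_seed_appears)
        qed (blast dest: seed_appears_imp_diverges)
        finally show ?thesis .
      qed
      have "?Y \<subseteq> Zd ?d \<rightarrow>\<^sub>E {..<C}" by (auto simp: window_shift_def)
      then have "f x \<in> inclusion_problem ?d ?Y \<longleftrightarrow>
          (\<forall>y. \<not> (\<exists>X\<in>?Y. appears_in ?d (map_of (seed k (start x y))) X))"
        unfolding inclusion_problem_def mem_Collect_eq eff subshift_def by blast
      then have "f x \<in> inclusion_problem ?d ?Y \<longleftrightarrow> (\<forall>y. halts U (start x y))"
        unfolding seed by simp
      then show ?thesis unfolding R(2) halts_start by simp
    qed
    ultimately show ?thesis unfolding many_one_reducible_def by blast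
  qed
qed

theorem theorem4p4:
  fixes d :: nat
  assumes "d \<ge> 2"
  shows "\<exists>Y. sft d Y \<and> Pi02_complete (inclusion_problem d Y)"
proof -
  obtain k where d: "d = Suc (Suc k)"
    using assms by (metis Suc_le_D numeral_2_eq_2 Suc_le_mono)
  obtain U where U: "\<And>e x y. halts U (Suc (search_code e x y 0)) \<longleftrightarrow> (\<exists>w. accepts e x y w)"
    using universal_search by blast
  obtain C where C: "2 < C" "\<And>m c i. reaches U (tm_initial m) c \<Longrightarrow> config_cell c i < C"
    using config_cells_bounded by blast
  let ?Y = "window_shift (Suc (Suc k)) C (bad_list U C)"
  have "Pi02 (inclusion_problem d ?Y)"
    unfolding d by (rule Pi02_inclusion_problem) (simp add: set_bad_list)
  moreover have "A \<le>\<^sub>m inclusion_problem d ?Y" if "Pi02 A" for A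
    unfolding d using U C that by (rule Pi02_reducible_to_inclusion_problem)
  moreover have "sft d ?Y"
    unfolding d by (rule sft_window_shift)
  ultimately show ?thesis unfolding Pi02_complete_def by blast
qed

end
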